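(* Let $(F_0,\nu_0)$ be an isoparametric hypersurface in $\mathbb{S}^{n+1}$, with associated Lagrangian immersion $\mathfrak{L}:M\to Q_n$. For every regular $t\in\mathcal{R}$ the tensor $\alpha^t(X,Y,Z)=g_t((\nabla^t_XA_t)Y,Z)$ and the second fundamental form $\hat\alpha(X,Y,Z)=\hat g(\hat A_{N_X}Y,Z)$ of the Lagrangian submanifold $\mathfrak{L}(M)\subset Q_n$ satisfy $$2\hat\alpha=\alpha^t .$$ In particular $\alpha^t$ is independent of $t\in\mathcal{R}$.
   Context: Setting. $M$ is a connected smooth $n$-manifold, $F_0:M\hookrightarrow\mathbb{S}^{n+1}\subset\mathbb{R}^{n+2}$ an embedding with unit normal field $\nu_0$ (tangent to the sphere) whose principal curvatures are constant (an isoparametric hypersurface). Shape operator: $d\nu_0=-dF_0A_0$. There are $g$ distinct principal curvatures $\lambda_1>\dots>\lambda_g$, $\lambda_j=\cot\theta_j$, with the standing normalization (choice of the hypersurface within its parallel family) $\theta_j=(2j-1)\frac{\pi}{2g}$ modulo $\pi$. Parallel surfaces: $F_t=\cos(t)F_0+\sin(t)\nu_0$, $\nu_t=-\sin(t)F_0+\cos(t)\nu_0$. Regular set: $\mathcal{R}=\mathbb{R}\setminus\{(2j+1)\frac{\pi}{2g}: j\in\mathbb{Z}\}$. For $t\in\mathcal{R}$, $F_t$ is an immersion; $g_t$ is the induced metric on $M$, $\nabla^t$ its Levi-Civita connection, and $A_t$ the shape operator, $d\nu_t=-dF_tA_t$. Complex quadric: $Q_n=\{[z]\in\mathbb{CP}^{n+1}: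 z_0^2+\dots+z_{n+1}^2=0\}$ with the Kähler metric $g_Q$ induced from the Fubini–Study metric of constant holomorphic curvature $4$, and complex structure $J$. Let $\pi$ be the projection $\mathbb{C}^{n+2}\setminus\{0\}\to\mathbb{CP}^{n+1}$, $\hat F_t=\frac{1}{\sqrt2}(F_t+i\nu_t):M\to\mathbb{S}^{2n+3}\subset\mathbb{C}^{n+2}$. One has $\hat F_t=e^{-it}\hat F_0$, so $\mathfrak{L}=\pi\circ\hat F_t:M\to Q_n$ does not depend on $t$; it is a Lagrangian immersion. Put $\hat g=\mathfrak{L}^*g_Q$. For $X\in TM$ let $N_X=-J\,d\mathfrak{L}(X)$ (a normal vector of $\mathfrak L$). For a normal vector $N$ the shape operator $\hat A_N$ is defined by $\hat g(\hat A_NY,Z)=g_Q(\mathrm{II}(Y,Z),N)$, where $\mathrm{II}$ is the vector-valued second fundamental form of $\mathfrak{L}$ in $(Q_n,g_Q)$. $X,Y,Z$ are vector fields on $M$. *)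

theory Defs
  imports "HOL-Analysis.Analysis"
begin

section \<open>Smooth maps between open subsets of Euclidean spaces\<close>

primrec C_on :: "nat \<Rightarrow> 'a::real_normed_vector set \<Rightarrow> ('a \<Rightarrow> 'b::real_normed_vector) \<Rightarrow> bool" where
  "C_on 0 U f \<longleftrightarrow> continuous_on U f"
| "C_on (Suc k) U f \<longleftrightarrow> (\<forall>x\<in>U. f differentiable at x) \<and>
     (\<forall>v. C_on k U (\<lambda>x. frechet_derivative f (at x) v))"

definition smooth_on :: "'a::real_normed_vector set \<Rightarrow> ('a \<Rightarrow> 'b::real_normed_vector) \<Rightarrow> bool" where
  "smooth_on U f \<longleftrightarrow> (\<forall>k. C_on k U f)"

abbreviation D :: "('a::real_normed_vector \<Rightarrow> 'b::real_normed_vector) \<Rightarrow> 'a \<Rightarrow> 'a \<Rightarrow> 'b" where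
  "D f x \<equiv> frechet_derivative f (at x)"


section \<open>Smooth manifolds, vector fields\<close>

text \<open>A chart is given by its inverse, a local parametrization: a pair of an open subset of the
  model space and a homeomorphism from it onto an open subset of the manifold.\<close>

type_synonym ('v, 'm) chart = "'v set \<times> ('v \<Rightarrow> 'm)"

definition is_chart :: "'m topology \<Rightarrow> ('v::euclidean_space, 'm) chart \<Rightarrow> bool" where
  "is_chart T c \<longleftrightarrow> open (fst c) \<and> openin T (snd c ` fst c) \<and>
     homeomorphic_map (top_of_set (fst c)) (subtopology T (snd c ` fst c)) (snd c)"

text \<open>The coordinate expression of a map \<open>f\<close> with respect to charts \<open>c\<close> and \<open>d\<close>, and the
  set where it is meaningful. For \<open>f = id\<close> this is a change of coordinates.\<close>

definition local_dom :: "('v, 'm) chart \<Rightarrow> ('w, 'p) chart \<Rightarrow> ('m \<Rightarrow> 'p) \<Rightarrow> 'v set" where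
  "local_dom c d f = {x \<in> fst c. f (snd c x) \<in> snd d ` fst d}"

definition local_rep :: "('v, 'm) chart \<Rightarrow> ('w, 'p) chart \<Rightarrow> ('m \<Rightarrow> 'p) \<Rightarrow> 'v \<Rightarrow> 'w" where
  "local_rep c d f x = inv_into (fst d) (snd d) (f (snd c x))"

definition smooth_manifold :: "'m topology \<Rightarrow> ('v::euclidean_space, 'm) chart set \<Rightarrow> bool" where
  "smooth_manifold T \<A> \<longleftrightarrow> Hausdorff_space T \<and> second_countable T \<and>
     (\<forall>c\<in>\<A>. is_chart T c) \<and> (\<Union>c\<in>\<A>. snd c ` fst c) = topspace T \<and>
     (\<forall>c\<in>\<A>. \<forall>d\<in>\<A>. smooth_on (local_dom c d id) (local_rep c d id))"

text \<open>A vector field is the family of its component functions in the charts of the atlas, subject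
  to the transformation law of tangent vectors.\<close>

type_synonym ('v, 'm) vfield = "('v, 'm) chart \<Rightarrow> 'v \<Rightarrow> 'v"

definition vector_field :: "('v::euclidean_space, 'm) chart set \<Rightarrow> ('v, 'm) vfield \<Rightarrow> bool" where
  "vector_field \<A> X \<longleftrightarrow> (\<forall>c\<in>\<A>. smooth_on (fst c) (X c)) \<and>
     (\<forall>c\<in>\<A>. \<forall>d\<in>\<A>. \<forall>x\<in>local_dom c d id.
        X d (local_rep c d id x) = D (local_rep c d id) x (X c x))"

definition smooth_map :: "('v::euclidean_space, 'm) chart set \<Rightarrow> ('m \<Rightarrow> 'a::real_normed_vector) \<Rightarrow> bool" where
  "smooth_map \<A> f \<longleftrightarrow> (\<forall>c\<in>\<A>. smooth_on (fst c) (f \<circ> snd c))"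

definition smooth_embedding ::
    "'m topology \<Rightarrow> ('v::euclidean_space, 'm) chart set \<Rightarrow> ('m \<Rightarrow> 'a::euclidean_space) \<Rightarrow> bool" where
  "smooth_embedding T \<A> f \<longleftrightarrow> smooth_map \<A> f \<and> embedding_map T euclidean f \<and>
     (\<forall>c\<in>\<A>. \<forall>x\<in>fst c. inj (D (f \<circ> snd c) x))"


section \<open>Riemannian geometry in a chart\<close>

text \<open>In a chart a metric is a function \<open>G\<close> with \<open>G x u v\<close> the product of the vectors \<open>u\<close>, \<open>v\<close> at
  the point \<open>x\<close>. A connection has the form \<open>D Y x (X x) + \<Gamma> x (X x) (Y x)\<close>; it is the Levi-Civita
  connection iff it is torsion free (\<open>\<Gamma>\<close> is symmetric) and metric.\<close>

type_synonym 'v metric_field = "'v \<Rightarrow> 'v \<Rightarrow> 'v \<Rightarrow> real"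

definition levi_civita :: "'v::euclidean_space metric_field \<Rightarrow> 'v \<Rightarrow> 'v \<Rightarrow> 'v \<Rightarrow> 'v" where
  "levi_civita G x = (THE \<Gamma>. bilinear \<Gamma> \<and> (\<forall>u v. \<Gamma> u v = \<Gamma> v u) \<and>
     (\<forall>w u v. D (\<lambda>y. G y u v) x w = G x (\<Gamma> w u) v + G x u (\<Gamma> w v)))"

definition nabla :: "'v::euclidean_space metric_field \<Rightarrow> ('v \<Rightarrow> 'v) \<Rightarrow> ('v \<Rightarrow> 'v) \<Rightarrow> 'v \<Rightarrow> 'v" where
  "nabla G X Y x = D Y x (X x) + levi_civita G x (X x) (Y x)"

text \<open>\<open>pullback G f\<close> is the metric induced by a map \<open>f\<close>; \<open>nabla_along G f Y Z\<close> is the derivative in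
  direction \<open>Y\<close> of the vector field \<open>df(Z)\<close> along \<open>f\<close>, for the Levi-Civita connection of the target.\<close>

definition pullback :: "'w::euclidean_space metric_field \<Rightarrow> ('v::euclidean_space \<Rightarrow> 'w) \<Rightarrow> 'v metric_field" where
  "pullback G f x u v = G (f x) (D f x u) (D f x v)"

definition nabla_along :: "'w::euclidean_space metric_field \<Rightarrow> ('v::euclidean_space \<Rightarrow> 'w) \<Rightarrow>
    ('v \<Rightarrow> 'v) \<Rightarrow> ('v \<Rightarrow> 'v) \<Rightarrow> 'v \<Rightarrow> 'w" where
  "nabla_along G f Y Z x =
     D (\<lambda>y. D f y (Z y)) x (Y x) + levi_civita G (f x) (D f x (Y x)) (D f x (Z x))"

definition normal_part :: "'w::euclidean_space metric_field \<Rightarrow> ('v::euclidean_space \<Rightarrow> 'w) \<Rightarrow> 'v \<Rightarrow> 'w \<Rightarrow> 'w" where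
  "normal_part G f x w =
     (THE n. (\<forall>u. G (f x) n (D f x u) = 0) \<and> w - n \<in> range (D f x))"

definition second_ff :: "'w::euclidean_space metric_field \<Rightarrow> ('v::euclidean_space \<Rightarrow> 'w) \<Rightarrow>
    ('v \<Rightarrow> 'v) \<Rightarrow> ('v \<Rightarrow> 'v) \<Rightarrow> 'v \<Rightarrow> 'w" where
  "second_ff G f Y Z x = normal_part G f x (nabla_along G f Y Z x)"

text \<open>The shape operator in the direction of the normal vector \<open>N\<close> at \<open>f x\<close>; since the second
  fundamental form is tensorial, it is evaluated on the constant extensions of \<open>u\<close> and \<open>v\<close>.\<close>

definition normal_shape_op :: "'w::euclidean_space metric_field \<Rightarrow> ('v::euclidean_space \<Rightarrow> 'w) \<Rightarrow>
    'v \<Rightarrow> 'w \<Rightarrow> 'v \<Rightarrow> 'v" where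
  "normal_shape_op G f x N u =
     (THE a. \<forall>v. pullback G f x a v = G (f x) (second_ff G f (\<lambda>_. u) (\<lambda>_. v) x) N)"


section \<open>Hypersurfaces in the unit sphere and their parallel surfaces\<close>

text \<open>In the next definitions \<open>f\<close> and \<open>\<nu>\<close> are coordinate expressions of the hypersurface and of its
  unit normal field.\<close>

definition shape_op :: "('v::euclidean_space \<Rightarrow> 'a::euclidean_space) \<Rightarrow> ('v \<Rightarrow> 'a) \<Rightarrow> 'v \<Rightarrow> 'v \<Rightarrow> 'v" where
  "shape_op f \<nu> x u = (THE w. D \<nu> x u = - D f x w)"

definition induced_metric :: "('v::euclidean_space \<Rightarrow> 'a::euclidean_space) \<Rightarrow> 'v metric_field" where
  "induced_metric f x u v = D f x u \<bullet> D f x v"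

definition principal_curvatures :: "('v::euclidean_space \<Rightarrow> 'a::euclidean_space) \<Rightarrow> ('v \<Rightarrow> 'a) \<Rightarrow> 'v \<Rightarrow> real set" where
  "principal_curvatures f \<nu> x = {k. \<exists>u. u \<noteq> 0 \<and> shape_op f \<nu> x u = k *\<^sub>R u}"

definition unit_normal :: "('v::euclidean_space, 'm) chart set \<Rightarrow> ('m \<Rightarrow> 'a::euclidean_space) \<Rightarrow> ('m \<Rightarrow> 'a) \<Rightarrow> bool" where
  "unit_normal \<A> F \<nu> \<longleftrightarrow> smooth_map \<A> \<nu> \<and>
     (\<forall>c\<in>\<A>. \<forall>x\<in>fst c. norm (\<nu> (snd c x)) = 1 \<and> \<nu> (snd c x) \<bullet> F (snd c x) = 0 \<and>
        (\<forall>u. \<nu> (snd c x) \<bullet> D (F \<circ> snd c) x u = 0))"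

definition isoparametric :: "'m topology \<Rightarrow> ('v::euclidean_space, 'm) chart set \<Rightarrow>
    ('m \<Rightarrow> 'a::euclidean_space) \<Rightarrow> ('m \<Rightarrow> 'a) \<Rightarrow> nat \<Rightarrow> (nat \<Rightarrow> real) \<Rightarrow> bool" where
  "isoparametric T \<A> F \<nu> g \<kappa> \<longleftrightarrow>
     smooth_embedding T \<A> F \<and> F ` topspace T \<subseteq> sphere 0 1 \<and> unit_normal \<A> F \<nu> \<and>
     (\<forall>i\<in>{1..g}. \<forall>j\<in>{1..g}. i < j \<longrightarrow> \<kappa> j < \<kappa> i) \<and>
     (\<forall>c\<in>\<A>. \<forall>x\<in>fst c. principal_curvatures (F \<circ> snd c) (\<nu> \<circ> snd c) x = \<kappa> ` {1..g})"

definition parallel_surface :: "('m \<Rightarrow> 'a::real_vector) \<Rightarrow> ('m \<Rightarrow> 'a) \<Rightarrow> real \<Rightarrow> 'm \<Rightarrow> 'a" where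
  "parallel_surface F \<nu> t p = cos t *\<^sub>R F p + sin t *\<^sub>R \<nu> p"

definition parallel_normal :: "('m \<Rightarrow> 'a::real_vector) \<Rightarrow> ('m \<Rightarrow> 'a) \<Rightarrow> real \<Rightarrow> 'm \<Rightarrow> 'a" where
  "parallel_normal F \<nu> t p = - sin t *\<^sub>R F p + cos t *\<^sub>R \<nu> p"

definition regular_set :: "nat \<Rightarrow> real set" where
  "regular_set g = UNIV - {(2 * real_of_int j + 1) * (pi / (2 * real g)) |j. True}"

text \<open>\<open>g\<^sub>t((\<nabla>\<^sup>t\<^sub>X A\<^sub>t) Y, Z)\<close>, evaluated in the chart \<open>c\<close> at the point with coordinates \<open>x\<close>.\<close>

definition alpha :: "('m \<Rightarrow> 'a::euclidean_space) \<Rightarrow> ('m \<Rightarrow> 'a) \<Rightarrow> real \<Rightarrow>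
    ('v::euclidean_space, 'm) vfield \<Rightarrow> ('v, 'm) vfield \<Rightarrow> ('v, 'm) vfield \<Rightarrow> ('v, 'm) chart \<Rightarrow> 'v \<Rightarrow> real" where
  "alpha F \<nu> t X Y Z c x =
     (let f = parallel_surface F \<nu> t \<circ> snd c;
          A = shape_op f (parallel_normal F \<nu> t \<circ> snd c);
          G = induced_metric f
      in G x (nabla G (X c) (\<lambda>y. A y (Y c y)) x - A x (nabla G (X c) (Y c) x)) (Z c x))"


section \<open>Complex projective space and the complex quadric\<close>

definition cproj :: "complex^'k \<Rightarrow> (complex^'k) set" where
  "cproj z = {a *s z |a. True}"

text \<open>Complex projective space carries the quotient topology.\<close>

definition cp_topology :: "(complex^'k) set topology" where
  "cp_topology =
     topology (\<lambda>U. U \<subseteq> cproj ` (- {0}) \<and> open {z. z \<noteq> 0 \<and> cproj z \<in> U})"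

lemma openin_cp_topology:
  "openin cp_topology U \<longleftrightarrow> U \<subseteq> cproj ` (- {0 :: complex^'k}) \<and> open {z. z \<noteq> 0 \<and> cproj z \<in> U}"
proof -
  let ?P = "\<lambda>U. U \<subseteq> cproj ` (- {0 :: complex^'k}) \<and> open {z. z \<noteq> 0 \<and> cproj z \<in> U}"
  have "istopology ?P"
    unfolding istopology_def
  proof (intro conjI allI impI)
    fix S T assume S: "?P S" and T: "?P T"
    have "{z. z \<noteq> 0 \<and> cproj z \<in> S \<inter> T} = {z. z \<noteq> 0 \<and> cproj z \<in> S} \<inter> {z. z \<noteq> 0 \<and> cproj z \<in> T}"
      by auto
    then show "open {z. z \<noteq> 0 \<and> cproj z \<in> S \<inter> T}"
      using S T by (simp only: open_Int)
    show "S \<inter> T \<subseteq> cproj ` (- {0 :: complex^'k})"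
      using S by blast
  next
    fix K assume K: "\<forall>S\<in>K. ?P S"
    have "{z. z \<noteq> 0 \<and> cproj z \<in> \<Union>K} = (\<Union>S\<in>K. {z. z \<noteq> 0 \<and> cproj z \<in> S})"
      by auto
    moreover have "open (\<Union>S\<in>K. {z. z \<noteq> 0 \<and> cproj z \<in> S})"
      by (rule open_UN) (use K in blast)
    ultimately show "open {z. z \<noteq> 0 \<and> cproj z \<in> \<Union>K}"
      by (simp only:)
    show "\<Union>K \<subseteq> cproj ` (- {0 :: complex^'k})"
      using K by blast
  qed
  then show ?thesis
    by (simp add: cp_topology_def topology_inverse')
qed

definition quadric :: "(complex^'k) set set" where
  "quadric = cproj ` {z. z \<noteq> 0 \<and> (\<Sum>i\<in>UNIV. (z $ i)\<^sup>2) = 0}"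

definition hermitian :: "complex^'k \<Rightarrow> complex^'k \<Rightarrow> complex" where
  "hermitian z w = (\<Sum>i\<in>UNIV. z $ i * cnj (w $ i))"

text \<open>The component of \<open>v\<close> orthogonal to the complex line \<open>cproj z\<close>. Its kernel is the kernel of the
  differential of \<open>cproj\<close> at \<open>z\<close>.\<close>

definition horizontal :: "complex^'k \<Rightarrow> complex^'k \<Rightarrow> complex^'k" where
  "horizontal z v = v - (hermitian v z / hermitian z z) *s z"

text \<open>The Fubini--Study product of the images of \<open>v\<close>, \<open>w\<close> under the differential of \<open>cproj\<close> at \<open>z\<close>.
  The restriction of \<open>cproj\<close> to the unit sphere is a Riemannian submersion, so that the
  holomorphic sectional curvature is \<open>4\<close>.\<close>

definition fubini_study :: "complex^'k \<Rightarrow> complex^'k \<Rightarrow> complex^'k \<Rightarrow> real" where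
  "fubini_study z v w = (horizontal z v \<bullet> horizontal z w) / (norm z)\<^sup>2"

text \<open>The smooth structure of the quadric is that of an embedded submanifold of projective space:
  its charts are the homeomorphisms from open sets of the model space of real dimension \<open>2n\<close> onto
  open sets of the quadric that have a smooth lift \<open>\<sigma>\<close> to \<open>complex^'k - {0}\<close> and are immersions into
  projective space. Lifts are required to exist on the whole chart domain; such charts suffice to
  cover the quadric.\<close>

definition is_lift :: "('w::euclidean_space, (complex^'k) set) chart \<Rightarrow> ('w \<Rightarrow> complex^'k) \<Rightarrow> bool" where
  "is_lift d \<sigma> \<longleftrightarrow> smooth_on (fst d) \<sigma> \<and>
     (\<forall>y\<in>fst d. \<sigma> y \<noteq> 0 \<and> cproj (\<sigma> y) = snd d y \<and>
        (\<forall>v. v \<noteq> 0 \<longrightarrow> horizontal (\<sigma> y) (D \<sigma> y v) \<noteq> 0))"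

definition quadric_atlas :: "(complex^'n, (complex^'k) set) chart set" where
  "quadric_atlas = {d. is_chart (subtopology cp_topology quadric) d \<and> (\<exists>\<sigma>. is_lift d \<sigma>)}"

text \<open>The metric and the complex structure do not depend on the choice of the lift.\<close>

definition lift :: "('w::euclidean_space, (complex^'k) set) chart \<Rightarrow> 'w \<Rightarrow> complex^'k" where
  "lift d = (SOME \<sigma>. is_lift d \<sigma>)"

definition quadric_metric :: "('w::euclidean_space, (complex^'k) set) chart \<Rightarrow> 'w metric_field" where
  "quadric_metric d y v w = fubini_study (lift d y) (D (lift d) y v) (D (lift d) y w)"

definition quadric_J :: "('w::euclidean_space, (complex^'k) set) chart \<Rightarrow> 'w \<Rightarrow> 'w \<Rightarrow> 'w" where
  "quadric_J d y v =
     (THE w. horizontal (lift d y) (D (lift d) y w) = horizontal (lift d y) (\<i> *s D (lift d) y v))"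


section \<open>The associated Lagrangian immersion\<close>

definition legendrian_lift :: "('m \<Rightarrow> real^'k) \<Rightarrow> ('m \<Rightarrow> real^'k) \<Rightarrow> real \<Rightarrow> 'm \<Rightarrow> complex^'k" where
  "legendrian_lift F \<nu> t p = (1 / sqrt 2) *\<^sub>R
     (\<chi> i. of_real (parallel_surface F \<nu> t p $ i) + \<i> * of_real (parallel_normal F \<nu> t p $ i))"

definition lagrangian :: "('m \<Rightarrow> real^'k) \<Rightarrow> ('m \<Rightarrow> real^'k) \<Rightarrow> 'm \<Rightarrow> (complex^'k) set" where
  "lagrangian F \<nu> p = cproj (legendrian_lift F \<nu> 0 p)"

lemma cproj_scale:
  assumes "a \<noteq> 0"
  shows "cproj (a *s z) = cproj z"
proof -
  have 1: "b *s (a *s z) \<in> cproj z" for b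
    unfolding cproj_def vector_smult_assoc by blast
  have "b *s z = (b / a) *s (a *s z)" for b
    unfolding vector_smult_assoc using assms by simp
  then have 2: "b *s z \<in> cproj (a *s z)" for b
    unfolding cproj_def by blast
  show ?thesis
  proof (intro equalityI subsetI)
    fix w assume "w \<in> cproj (a *s z)"
    then obtain b where "w = b *s (a *s z)"
      unfolding cproj_def by blast
    then show "w \<in> cproj z"
      using 1 by simp
  next
    fix w assume "w \<in> cproj z"
    then obtain b where "w = b *s z"
      unfolding cproj_def by blast
    then show "w \<in> cproj (a *s z)"
      using 2 by simp
  qed
qed

lemma legendrian_lift_rotate:
  "legendrian_lift F \<nu> t p = cis (- t) *s legendrian_lift F \<nu> 0 p"
proof -
  have "legendrian_lift F \<nu> t p $ i = (cis (- t) *s legendrian_lift F \<nu> 0 p) $ i" for i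
  proof (rule complex_eqI)
    show "Re (legendrian_lift F \<nu> t p $ i) = Re ((cis (- t) *s legendrian_lift F \<nu> 0 p) $ i)"
      by (simp add: legendrian_lift_def parallel_surface_def parallel_normal_def add_divide_distrib)
    show "Im (legendrian_lift F \<nu> t p $ i) = Im ((cis (- t) *s legendrian_lift F \<nu> 0 p) $ i)"
      by (simp add: legendrian_lift_def parallel_surface_def parallel_normal_def diff_divide_distrib)
  qed
  then show ?thesis
    by (simp only: vec_eq_iff) simp
qed

lemma lagrangian_eq: "cproj (legendrian_lift F \<nu> t p) = lagrangian F \<nu> p"
  unfolding lagrangian_def by (subst legendrian_lift_rotate) (simp add: cproj_scale)

text \<open>\<open>g\<^sub>L(A\<^sub>N Y, Z)\<close> with \<open>N = - J (dL(X))\<close> for an immersion \<open>L\<close> into the quadric with induced metric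
  \<open>g\<^sub>L\<close>, evaluated in the charts \<open>c\<close> and \<open>d\<close> at the point with coordinates \<open>x\<close>.\<close>

definition alpha_hat :: "('m \<Rightarrow> (complex^'k) set) \<Rightarrow> ('v::euclidean_space, 'm) vfield \<Rightarrow> ('v, 'm) vfield \<Rightarrow>
    ('v, 'm) vfield \<Rightarrow> ('v, 'm) chart \<Rightarrow> ('w::euclidean_space, (complex^'k) set) chart \<Rightarrow> 'v \<Rightarrow> real" where
  "alpha_hat L X Y Z c d x =
     (let l = local_rep c d L;
          G = quadric_metric d;
          N = - quadric_J d (l x) (D l x (X c x))
      in pullback G l x (normal_shape_op G l x N (Y c x)) (Z c x))"

end

theory Submission
  imports Defs
begin

text \<open>In a chart write \<open>f\<close>, \<open>\<nu>\<close> for the hypersurface and its normal. Both tensors are values of the cubic form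
  \<open>\<langle>D\<^sup>2f(u, v), D\<nu>(w)\<rangle> - \<langle>D\<^sup>2\<nu>(u, v), Df(w)\<rangle>\<close>, which is \<open>-2\<close> times the imaginary part of the Hermitian product of
  \<open>D\<^sup>2h(u, v)\<close> and \<open>Dh(w)\<close> for the Legendrian lift \<open>h = (f + i\<nu>)/\<surd>2\<close>; hence it is invariant under the rotation
  \<open>h \<mapsto> exp(-it) h\<close> that passes to the parallel surfaces. Differentiating the Lagrangian condition shows
  that it is symmetric in all three arguments. For \<open>\<alpha>\<^sup>t\<close> the formula follows from \<open>df \<circ> A = -d\<nu>\<close> and the
  Gauss formula. For the quadric, the affine normalization of lifts at the given point turns the
  Fubini--Study metric into a metric that is Euclidean to first order, so that covariant derivatives become
  ordinary derivatives of \<open>h\<close> up to multiples of \<open>h\<close>. The standing normalization of the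
  principal curvatures only enters through the fact that \<open>F\<^sub>t\<close> is an immersion for regular \<open>t\<close>.\<close>

section \<open>Second derivatives\<close>

text \<open>The Levi-Civita connection, the normal part, both shape operators and
  \<open>quadric_J\<close> are definite descriptions, so each needs existence and uniqueness before
  it can be computed; for \<open>quadric_J\<close>, and for the tangentiality of
  \<open>D \<nu>\<close> behind the shape operator, existence is a dimension count. The second
  obstacle is regularity: the field \<open>A Y\<close> and the chart expression \<open>l\<close> of
  the Lagrangian immersion are known only implicitly, through \<open>D f (A Y) = - D \<nu> Y\<close>
  and \<open>\<tau> (l y) = \<phi> y\<close>. Left inverses of injective derivatives yield their
  differentiability.

  Lifts are normalized at \<open>z = h x\<close>, where two orthogonality relations make the
  corrections harmless: the affine condition forces \<open>D \<tau>\<close> to be orthogonal to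
  \<open>z\<close>, and the Legendrian condition forces \<open>D h\<close> to be orthogonal to
  \<open>h\<close>. What survives at second order is a multiple of \<open>h x\<close>, and the
  normal vector, which is represented by \<open>D h\<close> times minus the imaginary unit, is
  orthogonal to that too. The factor 2 is the inverse square of the constant 1 / sqrt 2 that gives
  \<open>h\<close> unit length.\<close>

definition twice_differentiable_at ::
    "('a::real_normed_vector \<Rightarrow> 'b::real_normed_vector) \<Rightarrow> 'a \<Rightarrow> bool" where
  "twice_differentiable_at f x \<longleftrightarrow> (\<forall>\<^sub>F y in nhds x. f differentiable at y) \<and>
     (\<forall>v. (\<lambda>y. D f y v) differentiable at x)"

definition D2 :: "('a::real_normed_vector \<Rightarrow> 'b::real_normed_vector) \<Rightarrow> 'a \<Rightarrow> 'a \<Rightarrow> 'a \<Rightarrow> 'b" where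
  "D2 f x u v = D (\<lambda>y. D f y v) x u"

lemma D_eqI: "(f has_derivative f') (at x) \<Longrightarrow> D f x = f'"
  by (rule frechet_derivative_at[symmetric])

lemma D_works: "f differentiable at x \<Longrightarrow> (f has_derivative D f x) (at x)"
  by (simp add: frechet_derivative_works)

lemma has_derivative_cong_nhds:
  assumes "\<forall>\<^sub>F y in nhds x. f y = g y"
  shows "(f has_derivative f') (at x) \<longleftrightarrow> (g has_derivative f') (at x)"
proof -
  have "\<forall>\<^sub>F y in at x. f y = g y" "f x = g x" "\<forall>\<^sub>F y in at x. g y = f y"
    using assms by (auto simp: eventually_nhds_conv_at eq_commute)
  then show ?thesis
    using has_derivative_transform_eventually[of f f' x UNIV g]
      has_derivative_transform_eventually[of g f' x UNIV f] by auto
qed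

lemma D_cong_nhds: "\<forall>\<^sub>F y in nhds x. f y = g y \<Longrightarrow> D f x = D g x"
  using has_derivative_cong_nhds[of f g x] by (simp add: frechet_derivative_def)

lemma differentiable_cong_nhds:
  "\<forall>\<^sub>F y in nhds x. f y = g y \<Longrightarrow> f differentiable at x \<longleftrightarrow> g differentiable at x"
  using has_derivative_cong_nhds[of f g x] by (simp add: differentiable_def)

lemma eventually_nhds_nhds: "eventually P (nhds x) \<Longrightarrow> \<forall>\<^sub>F y in nhds x. eventually P (nhds y)"
  by (simp add: eventually_eventually)

lemma differentiable_at_if_twice: "twice_differentiable_at f x \<Longrightarrow> f differentiable at x"
  unfolding twice_differentiable_at_def by (metis eventually_nhds_x_imp_x)

lemma twice_differentiable_atD: "twice_differentiable_at f x \<Longrightarrow> (\<lambda>y. D f y v) differentiable at x"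
  by (simp add: twice_differentiable_at_def)

lemma has_derivative_D: "twice_differentiable_at f x \<Longrightarrow>
    ((\<lambda>y. D f y v) has_derivative (\<lambda>u. D2 f x u v)) (at x)"
  using D_works[OF twice_differentiable_atD] by (simp add: D2_def)

lemma twice_differentiable_at_cong:
  assumes "\<forall>\<^sub>F y in nhds x. f y = g y" "twice_differentiable_at f x"
  shows "twice_differentiable_at g x" "D2 g x = D2 f x"
proof -
  have ev: "\<forall>\<^sub>F y in nhds x. \<forall>\<^sub>F z in nhds y. f z = g z"
    by (rule eventually_nhds_nhds[OF assms(1)])
  have evD: "\<forall>\<^sub>F y in nhds x. D f y v = D g y v" for v
    using ev by eventually_elim (simp add: D_cong_nhds)
  have "\<forall>\<^sub>F y in nhds x. f differentiable at y"
    using assms(2) by (simp add: twice_differentiable_at_def)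
  then have "\<forall>\<^sub>F y in nhds x. g differentiable at y"
    using ev by eventually_elim (metis differentiable_cong_nhds)
  then show "twice_differentiable_at g x"
    using assms(2) differentiable_cong_nhds[OF evD] by (simp add: twice_differentiable_at_def)
  show "D2 g x = D2 f x"
    by (intro ext) (simp add: D2_def D_cong_nhds[OF evD])
qed

text \<open>The entry point for the smoothness hypotheses. The pointwise notion is strong enough for
  symmetry of \<open>D2\<close> and weak enough to be recovered for the implicitly given
  \<open>l\<close>.\<close>

lemma smooth_on_twice_differentiable:
  assumes "smooth_on U f" "open U" "x \<in> U"
  shows "twice_differentiable_at f x"
proof -
  have C: "C_on (Suc (Suc 0)) U f"
    using assms(1) unfolding smooth_on_def by blast
  have "\<forall>\<^sub>F y in nhds x. y \<in> U"
    using assms by (simp add: eventually_nhds_in_open)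
  then show ?thesis
    using C assms(3) unfolding twice_differentiable_at_def by (auto elim!: eventually_mono)
qed

lemma linear_D: "f differentiable at x \<Longrightarrow> linear (D f x)"
  by (rule linear_frechet_derivative)

text \<open>\<open>D2\<close> differentiates with its second slot frozen, so linearity there is not
  automatic; it is inherited from the linearity of \<open>D f y\<close> at all \<open>y\<close> near
  \<open>x\<close>.\<close>

lemma D2_linear_right:
  assumes "twice_differentiable_at f x"
  shows "D2 f x u (a *\<^sub>R v + b *\<^sub>R w) = a *\<^sub>R D2 f x u v + b *\<^sub>R D2 f x u w"
proof -
  have "\<forall>\<^sub>F y in nhds x. f differentiable at y"
    using assms by (simp add: twice_differentiable_at_def)
  then have ev: "\<forall>\<^sub>F y in nhds x. D f y (a *\<^sub>R v + b *\<^sub>R w) = a *\<^sub>R D f y v + b *\<^sub>R D f y w"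
    by eventually_elim (simp add: linear_add[OF linear_D] linear_cmul[OF linear_D])
  have "((\<lambda>y. a *\<^sub>R D f y v + b *\<^sub>R D f y w) has_derivative
      (\<lambda>u. a *\<^sub>R D2 f x u v + b *\<^sub>R D2 f x u w)) (at x)"
    using assms by (intro derivative_intros has_derivative_D)
  then show ?thesis
    unfolding D2_def[of f x u "a *\<^sub>R v + b *\<^sub>R w"] D_cong_nhds[OF ev] by (simp add: D_eqI)
qed

lemma bilinear_D2:
  assumes "twice_differentiable_at f x"
  shows "bilinear (D2 f x)"
  unfolding bilinear_def
proof safe
  fix u
  show "linear (D2 f x u)"
  proof (rule linearI)
    show "D2 f x u (v + w) = D2 f x u v + D2 f x u w" for v w
      using D2_linear_right[OF assms, of u 1 v 1 w] by simp
    show "D2 f x u (a *\<^sub>R v) = a *\<^sub>R D2 f x u v" for a v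
      using D2_linear_right[OF assms, of u a v 0 0] by simp
  qed
next
  fix v
  show "linear (\<lambda>u. D2 f x u v)"
    using has_derivative_linear[OF has_derivative_D[OF assms]] .
qed

text \<open>The mean value theorem in direction \<open>v\<close> turns the second difference into an
  increment of \<open>D f\<close> along \<open>u\<close>, and differentiability of the directional
  derivative at the single point \<open>x\<close> controls that increment.\<close>

lemma second_difference_real:
  fixes f :: "'a::real_normed_vector \<Rightarrow> real"
  assumes f: "twice_differentiable_at f x" and "e > 0"
  shows "\<exists>d>0. \<forall>s. 0 < s \<and> s < d \<longrightarrow>
    \<bar>f (x + s *\<^sub>R u + s *\<^sub>R v) - f (x + s *\<^sub>R u) - f (x + s *\<^sub>R v) + f x - s\<^sup>2 * D2 f x u v\<bar> \<le> e * s\<^sup>2"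
proof -
  define K where "K = norm u + norm v + 1"
  have K: "K > 0" by (simp add: K_def add_nonneg_pos)
  define k where "k = (\<lambda>y. D f y v)"
  have k': "(k has_derivative (\<lambda>u. D2 f x u v)) (at x)"
    unfolding k_def by (rule has_derivative_D[OF f])
  \<comment> \<open>Two values of \<open>k\<close> get compared, each within
    \<open>e' * (s * K)\<close> of its linearization; \<open>s * K\<close> bounds the displacements
    from \<open>x\<close>.\<close>
  define e' where "e' = e / (2 * K)"
  have "e' > 0" using K \<open>e > 0\<close> by (simp add: e'_def)
  then obtain d1 where d1: "d1 > 0"
    "\<And>y. norm (y - x) < d1 \<Longrightarrow> norm (k y - k x - D2 f x (y - x) v) \<le> e' * norm (y - x)"
    using k' unfolding has_derivative_at_alt by blast
  obtain d2 where d2: "d2 > 0" "\<And>y. dist y x < d2 \<Longrightarrow> f differentiable at y"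
    using f unfolding twice_differentiable_at_def eventually_nhds_metric by blast
  define d where "d = min d1 d2 / K"
  have "d > 0" using d1 d2 K by (simp add: d_def)
  moreover have "\<bar>f (x + s *\<^sub>R u + s *\<^sub>R v) - f (x + s *\<^sub>R u) - f (x + s *\<^sub>R v) + f x - s\<^sup>2 * D2 f x u v\<bar> \<le> e * s\<^sup>2"
    if s: "0 < s" "s < d" for s
  proof -
    have sK: "s * K < d1" "s * K < d2"
      using s K by (simp_all add: d_def pos_less_divide_eq)
    have small: "norm (a *\<^sub>R u + r *\<^sub>R v) \<le> s * K" if "0 \<le> a" "a \<le> s" "0 \<le> r" "r \<le> s" for a r
    proof -
      have "norm (a *\<^sub>R u + r *\<^sub>R v) \<le> a * norm u + r * norm v"
        using norm_triangle_ineq[of "a *\<^sub>R u" "r *\<^sub>R v"] that by simp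
      also have "\<dots> \<le> s * norm u + s * norm v"
        using that by (intro add_mono mult_right_mono) auto
      also have "\<dots> \<le> s * K" using s by (simp add: K_def algebra_simps)
      finally show ?thesis .
    qed
    have diff: "f differentiable at (x + a *\<^sub>R u + r *\<^sub>R v)" if "0 \<le> a" "a \<le> s" "0 \<le> r" "r \<le> s" for a r
      using small[OF that] sK d2 by (auto simp: dist_norm algebra_simps)
    have kb: "\<bar>k (x + a *\<^sub>R u + r *\<^sub>R v) - k x - D2 f x (a *\<^sub>R u + r *\<^sub>R v) v\<bar> \<le> e' * (s * K)"
      if "0 \<le> a" "a \<le> s" "0 \<le> r" "r \<le> s" for a r
    proof -
      have "norm ((x + a *\<^sub>R u + r *\<^sub>R v) - x) < d1"
        using small[OF that] sK by (simp add: algebra_simps)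
      from d1(2)[OF this] have "\<bar>k (x + a *\<^sub>R u + r *\<^sub>R v) - k x - D2 f x (a *\<^sub>R u + r *\<^sub>R v) v\<bar> \<le> e' * norm (a *\<^sub>R u + r *\<^sub>R v)"
        by (simp add: algebra_simps)
      also have "\<dots> \<le> e' * (s * K)"
        using small[OF that] \<open>e' > 0\<close> by simp
      finally show ?thesis .
    qed
    \<comment> \<open>The summand \<open>0 *\<^sub>R u\<close> keeps both terms in the shape covered
      by \<open>deriv\<close> and \<open>kb\<close>, with \<open>a = s\<close> and
      \<open>a = 0\<close>.\<close>
    define g where "g = (\<lambda>r. f (x + s *\<^sub>R u + r *\<^sub>R v) - f (x + 0 *\<^sub>R u + r *\<^sub>R v))"
    have deriv: "((\<lambda>r. f (x + a *\<^sub>R u + r *\<^sub>R v)) has_real_derivative k (x + a *\<^sub>R u + r *\<^sub>R v)) (at r)"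
      if "0 \<le> a" "a \<le> s" "0 \<le> r" "r \<le> s" for a r
    proof -
      have "((\<lambda>r. f (x + a *\<^sub>R u + r *\<^sub>R v)) has_derivative
          (\<lambda>h. D f (x + a *\<^sub>R u + r *\<^sub>R v) (h *\<^sub>R v))) (at r)"
        by (rule has_derivative_compose[where g = f and f = "\<lambda>r. x + a *\<^sub>R u + r *\<^sub>R v",
              OF _ D_works[OF diff[OF that]]]) (auto intro!: derivative_eq_intros)
      moreover have "(\<lambda>h. D f (x + a *\<^sub>R u + r *\<^sub>R v) (h *\<^sub>R v)) = (*) (k (x + a *\<^sub>R u + r *\<^sub>R v))"
        using linear_cmul[OF linear_D[OF diff[OF that]]] by (auto simp: k_def)
      ultimately show ?thesis by (simp add: has_field_derivative_def)
    qed
    have g': "(g has_real_derivative k (x + s *\<^sub>R u + r *\<^sub>R v) - k (x + 0 *\<^sub>R u + r *\<^sub>R v)) (at r)"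
      if "0 \<le> r" "r \<le> s" for r
      unfolding g_def by (intro DERIV_diff deriv) (use that s in auto)
    obtain z where z: "0 < z" "z < s"
      "g s - g 0 = (s - 0) * (k (x + s *\<^sub>R u + z *\<^sub>R v) - k (x + 0 *\<^sub>R u + z *\<^sub>R v))"
      using MVT2[OF s(1) g'] by blast
    have lin: "linear (\<lambda>u. D2 f x u v)"
      using bilinear_D2[OF f] by (simp add: bilinear_def)
    have "D2 f x (s *\<^sub>R u + z *\<^sub>R v) v - D2 f x (0 *\<^sub>R u + z *\<^sub>R v) v = s * D2 f x u v"
      by (simp add: linear_add[OF lin] linear_cmul[OF lin])
    then have "\<bar>k (x + s *\<^sub>R u + z *\<^sub>R v) - k (x + 0 *\<^sub>R u + z *\<^sub>R v) - s * D2 f x u v\<bar> \<le> 2 * (e' * (s * K))"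
      using kb[of s z] kb[of 0 z] s z by linarith
    then have "s * \<bar>k (x + s *\<^sub>R u + z *\<^sub>R v) - k (x + 0 *\<^sub>R u + z *\<^sub>R v) - s * D2 f x u v\<bar> \<le> s * (2 * (e' * (s * K)))"
      using s by (intro mult_left_mono) auto
    also have "\<dots> = e * s\<^sup>2"
      using K by (simp add: e'_def power2_eq_square)
    also have "s * \<bar>k (x + s *\<^sub>R u + z *\<^sub>R v) - k (x + 0 *\<^sub>R u + z *\<^sub>R v) - s * D2 f x u v\<bar>
        = \<bar>g s - g 0 - s\<^sup>2 * D2 f x u v\<bar>"
    proof -
      have "g s - g 0 - s\<^sup>2 * D2 f x u v =
          s * (k (x + s *\<^sub>R u + z *\<^sub>R v) - k (x + 0 *\<^sub>R u + z *\<^sub>R v) - s * D2 f x u v)"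
        unfolding z(3) by (simp add: algebra_simps power2_eq_square)
      then show ?thesis using s(1) by (simp add: abs_mult)
    qed
    finally show ?thesis by (simp add: g_def algebra_simps)
  qed
  ultimately show ?thesis by blast
qed

text \<open>The second difference is symmetric in \<open>u\<close> and \<open>v\<close> and
  approximates both values. Taking \<open>e\<close> as a third of their gap makes the two errors
  together too small to bridge it.\<close>

lemma D2_symmetric_real:
  fixes f :: "'a::real_normed_vector \<Rightarrow> real"
  assumes f: "twice_differentiable_at f x"
  shows "D2 f x u v = D2 f x v u"
proof (rule ccontr)
  assume "D2 f x u v \<noteq> D2 f x v u"
  define e where "e = \<bar>D2 f x u v - D2 f x v u\<bar> / 3"
  have "e > 0" using \<open>_ \<noteq> _\<close> by (simp add: e_def)
  obtain d1 where d1: "d1 > 0" "\<And>s. 0 < s \<Longrightarrow> s < d1 \<Longrightarrow>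
    \<bar>f (x + s *\<^sub>R u + s *\<^sub>R v) - f (x + s *\<^sub>R u) - f (x + s *\<^sub>R v) + f x - s\<^sup>2 * D2 f x u v\<bar> \<le> e * s\<^sup>2"
    using second_difference_real[OF f \<open>e > 0\<close>] by metis
  obtain d2 where d2: "d2 > 0" "\<And>s. 0 < s \<Longrightarrow> s < d2 \<Longrightarrow>
    \<bar>f (x + s *\<^sub>R v + s *\<^sub>R u) - f (x + s *\<^sub>R v) - f (x + s *\<^sub>R u) + f x - s\<^sup>2 * D2 f x v u\<bar> \<le> e * s\<^sup>2"
    using second_difference_real[OF f \<open>e > 0\<close>] by metis
  obtain s where s: "0 < s" "s < d1" "s < d2"
    using field_lbound_gt_zero[OF d1(1) d2(1)] by blast
  have "\<bar>s\<^sup>2 * D2 f x u v - s\<^sup>2 * D2 f x v u\<bar> \<le> 2 * (e * s\<^sup>2)"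
    using d1(2)[OF s(1,2)] d2(2)[OF s(1,3)] by (simp add: algebra_simps)
  moreover have "\<bar>s\<^sup>2 * D2 f x u v - s\<^sup>2 * D2 f x v u\<bar> = s\<^sup>2 * (3 * e)"
    by (simp add: e_def abs_mult flip: right_diff_distrib)
  moreover have "e * s\<^sup>2 > 0" using s \<open>e > 0\<close> by simp
  ultimately show False by (simp add: algebra_simps)
qed

section \<open>Calculus rules for twice differentiable maps\<close>

lemma D_bounded_linear:
  assumes "bounded_linear L" "f differentiable at x"
  shows "D (\<lambda>y. L (f y)) x = (\<lambda>v. L (D f x v))"
  by (rule D_eqI bounded_linear.has_derivative[OF assms(1)] D_works assms(2))+

lemma twice_differentiable_at_bounded_linear:
  assumes L: "bounded_linear L" and f: "twice_differentiable_at f x"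
  shows "twice_differentiable_at (\<lambda>y. L (f y)) x" "D2 (\<lambda>y. L (f y)) x u v = L (D2 f x u v)"
proof -
  have fd: "\<forall>\<^sub>F y in nhds x. f differentiable at y"
    using f by (simp add: twice_differentiable_at_def)
  then have ev: "\<forall>\<^sub>F y in nhds x. D (\<lambda>y. L (f y)) y v = L (D f y v)" for v
    by eventually_elim (simp add: D_bounded_linear[OF L])
  have der: "((\<lambda>y. L (D f y v)) has_derivative (\<lambda>u. L (D2 f x u v))) (at x)" for v
    by (rule bounded_linear.has_derivative[OF L has_derivative_D[OF f]])
  show "D2 (\<lambda>y. L (f y)) x u v = L (D2 f x u v)"
    using D_eqI[OF der] by (simp add: D2_def D_cong_nhds[OF ev])
  have "\<forall>\<^sub>F y in nhds x. (\<lambda>y. L (f y)) differentiable at y"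
    using fd by eventually_elim (rule differentiableI[OF bounded_linear.has_derivative[OF L D_works]])
  moreover have "(\<lambda>y. D (\<lambda>y. L (f y)) y v) differentiable at x" for v
    unfolding differentiable_cong_nhds[OF ev] by (rule differentiableI[OF der])
  ultimately show "twice_differentiable_at (\<lambda>y. L (f y)) x"
    by (simp add: twice_differentiable_at_def)
qed

text \<open>Reduction to real-valued maps by pairing with the defect of symmetry itself, whose norm
  then vanishes.\<close>

lemma D2_symmetric:
  fixes f :: "'a::real_normed_vector \<Rightarrow> 'b::real_inner"
  assumes "twice_differentiable_at f x"
  shows "D2 f x u v = D2 f x v u"
proof -
  let ?w = "D2 f x u v - D2 f x v u"
  note L = twice_differentiable_at_bounded_linear[OF bounded_linear_inner_left[of ?w] assms]
  have "?w \<bullet> ?w = 0"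
    using D2_symmetric_real[OF L(1), of u v] by (simp add: L(2) inner_diff_left)
  then show ?thesis by simp
qed

lemma D_bilinear:
  assumes B: "bounded_bilinear B" and "f differentiable at x" "g differentiable at x"
  shows "D (\<lambda>y. B (f y) (g y)) x v = B (f x) (D g x v) + B (D f x v) (g x)"
  using D_eqI[OF bounded_bilinear.FDERIV[OF B D_works[OF assms(2)] D_works[OF assms(3)]]] by simp

lemma twice_differentiable_at_bilinear:
  assumes B: "bounded_bilinear B"
    and f: "twice_differentiable_at f x" and g: "twice_differentiable_at g x"
  shows "twice_differentiable_at (\<lambda>y. B (f y) (g y)) x"
    and "D2 (\<lambda>y. B (f y) (g y)) x u v = B (f x) (D2 g x u v) + B (D f x u) (D g x v) +
           (B (D f x v) (D g x u) + B (D2 f x u v) (g x))"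
proof -
  have fg: "\<forall>\<^sub>F y in nhds x. f differentiable at y \<and> g differentiable at y"
    using f g by (auto simp: twice_differentiable_at_def eventually_conj)
  then have ev: "\<forall>\<^sub>F y in nhds x.
      D (\<lambda>y. B (f y) (g y)) y v = B (f y) (D g y v) + B (D f y v) (g y)" for v
    by eventually_elim (simp add: D_bilinear[OF B])
  have der: "((\<lambda>y. B (f y) (D g y v) + B (D f y v) (g y)) has_derivative
      (\<lambda>u. B (f x) (D2 g x u v) + B (D f x u) (D g x v) +
           (B (D f x v) (D g x u) + B (D2 f x u v) (g x)))) (at x)" for v
    by (intro has_derivative_add bounded_bilinear.FDERIV[OF B] has_derivative_D f g D_works
        differentiable_at_if_twice)
  show "D2 (\<lambda>y. B (f y) (g y)) x u v = B (f x) (D2 g x u v) + B (D f x u) (D g x v) +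
           (B (D f x v) (D g x u) + B (D2 f x u v) (g x))"
    unfolding D2_def[of "\<lambda>y. B (f y) (g y)"] D_cong_nhds[OF ev] by (simp add: D_eqI[OF der])
  have "\<forall>\<^sub>F y in nhds x. (\<lambda>y. B (f y) (g y)) differentiable at y"
    using fg by eventually_elim (blast intro: differentiableI bounded_bilinear.FDERIV[OF B] D_works)
  moreover have "(\<lambda>y. D (\<lambda>y. B (f y) (g y)) y v) differentiable at x" for v
    unfolding differentiable_cong_nhds[OF ev] by (rule differentiableI[OF der])
  ultimately show "twice_differentiable_at (\<lambda>y. B (f y) (g y)) x"
    by (simp add: twice_differentiable_at_def)
qed

lemma twice_differentiable_at_inverse:
  fixes f :: "'a::real_normed_vector \<Rightarrow> complex"
  assumes f: "twice_differentiable_at f x" and "f x \<noteq> 0"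
  shows "twice_differentiable_at (\<lambda>y. inverse (f y)) x"
proof -
  have "isCont f x"
    using differentiable_at_if_twice[OF f] differentiable_imp_continuous_within by blast
  then have "\<forall>\<^sub>F y in nhds x. f y \<noteq> 0"
    using assms(2) by (simp add: isCont_def tendsto_at_iff_tendsto_nhds tendsto_imp_eventually_ne)
  then have nz: "\<forall>\<^sub>F y in nhds x. f y \<noteq> 0 \<and> f differentiable at y"
    using f by (auto simp: twice_differentiable_at_def eventually_conj)
  have inv: "((\<lambda>y. inverse (f y)) has_derivative (\<lambda>h. - (inverse (f y) * D f y h * inverse (f y)))) (at y)"
    if "f y \<noteq> 0" "f differentiable at y" for y
    by (rule Deriv.has_derivative_inverse[OF that(1) D_works[OF that(2)]])
  have ev: "\<forall>\<^sub>F y in nhds x. D (\<lambda>y. inverse (f y)) y v = - (inverse (f y) * D f y v * inverse (f y))" for v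
    using nz by eventually_elim (simp add: D_eqI[OF inv])
  have "(\<lambda>y. - (inverse (f y) * D f y v * inverse (f y))) differentiable at x" for v
    by (intro differentiable_minus differentiable_mult twice_differentiable_atD f
        differentiableI[OF inv] assms(2) differentiable_at_if_twice[OF f])
  moreover have "\<forall>\<^sub>F y in nhds x. (\<lambda>y. inverse (f y)) differentiable at y"
    using nz by eventually_elim (simp add: differentiableI[OF inv])
  ultimately show ?thesis
    by (simp add: twice_differentiable_at_def differentiable_cong_nhds[OF ev])
qed

lemma linear_eq_sum_Basis:
  fixes f :: "'a::euclidean_space \<Rightarrow> 'b::real_normed_vector"
  assumes "linear L"
  shows "L w = (\<Sum>b\<in>Basis. (w \<bullet> b) *\<^sub>R L b)"
  using linear_sum[OF assms, of "\<lambda>b. (w \<bullet> b) *\<^sub>R b" Basis] linear_cmul[OF assms]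
  by (simp add: euclidean_representation)

text \<open>Twice differentiability speaks about fixed directions only. The moving direction
  \<open>W y\<close> is therefore expanded in the basis, which leaves fixed directions with
  differentiable coefficients.\<close>

lemma has_derivative_D_field:
  fixes f :: "'a::euclidean_space \<Rightarrow> 'b::real_normed_vector"
    and l W :: "'c::real_normed_vector \<Rightarrow> 'a"
  assumes f: "twice_differentiable_at f (l x)" and l: "l differentiable at x"
    and W: "W differentiable at x"
  shows "((\<lambda>y. D f (l y) (W y)) has_derivative
    (\<lambda>u. D2 f (l x) (D l x u) (W x) + D f (l x) (D W x u))) (at x)"
proof -
  have "\<forall>\<^sub>F z in nhds (l x). f differentiable at z"
    using f by (simp add: twice_differentiable_at_def)
  moreover have "filterlim l (nhds (l x)) (nhds x)"
    using differentiable_imp_continuous_within[OF l] by (simp add: continuous_at tendsto_at_iff_tendsto_nhds)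
  ultimately have "\<forall>\<^sub>F y in nhds x. f differentiable at (l y)"
    by (rule eventually_compose_filterlim)
  then have ev: "\<forall>\<^sub>F y in nhds x. (\<Sum>b\<in>Basis. (W y \<bullet> b) *\<^sub>R D f (l y) b) = D f (l y) (W y)"
    by eventually_elim (rule linear_eq_sum_Basis[OF linear_D, symmetric])
  have "((\<lambda>y. \<Sum>b\<in>Basis. (W y \<bullet> b) *\<^sub>R D f (l y) b) has_derivative
      (\<lambda>u. \<Sum>b\<in>Basis. (W x \<bullet> b) *\<^sub>R D2 f (l x) (D l x u) b + (D W x u \<bullet> b) *\<^sub>R D f (l x) b)) (at x)"
    by (intro has_derivative_sum has_derivative_scaleR has_derivative_inner_left D_works W
        has_derivative_compose[OF D_works[OF l] has_derivative_D[OF f]])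
  moreover have "(\<Sum>b\<in>Basis. (W x \<bullet> b) *\<^sub>R D2 f (l x) (D l x u) b + (D W x u \<bullet> b) *\<^sub>R D f (l x) b) =
      D2 f (l x) (D l x u) (W x) + D f (l x) (D W x u)" for u
    using bilinear_D2[OF f] linear_D[OF differentiable_at_if_twice[OF f]]
    by (simp add: sum.distrib linear_eq_sum_Basis[of _ "W x"] linear_eq_sum_Basis[of _ "D W x u"] bilinear_def)
  ultimately show ?thesis
    using has_derivative_cong_nhds[OF ev] by simp
qed

section \<open>Differentiability of implicitly defined maps\<close>

text \<open>The error is measured against the unknown increment of \<open>W\<close>. Tolerance 1/2
  absorbs it and bounds that increment by a multiple of \<open>norm (y - x)\<close>; with this bound
  a small tolerance becomes a genuine remainder estimate.\<close>

lemma has_derivative_implicit: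
  fixes W :: "'a::real_normed_vector \<Rightarrow> 'b::real_normed_vector"
  assumes r: "(r has_derivative r') (at x)" "r x = 0"
    and W: "\<And>e. e > 0 \<Longrightarrow> \<forall>\<^sub>F y in nhds x. norm (W y - W x - r y) \<le> e * norm (W y - W x)"
  shows "(W has_derivative r') (at x)"
  unfolding has_derivative_at_alt
proof (intro conjI allI impI)
  show "bounded_linear r'" using r(1) by (rule has_derivative_bounded_linear)
  then obtain K where K: "K > 0" "\<And>h. norm (r' h) \<le> norm h * K"
    using bounded_linear.pos_bounded by blast
  fix e :: real assume "e > 0"
  have rev: "\<forall>\<^sub>F y in nhds x. norm (r y - r' (y - x)) \<le> e' * norm (y - x)" if "e' > 0" for e'
    using r that unfolding has_derivative_at_alt eventually_nhds_metric by (simp add: dist_norm)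
  have e4: "e / (4 * (K + 1)) > 0" using \<open>e > 0\<close> K(1) by simp
  have "\<forall>\<^sub>F y in nhds x. norm (W y - W x - r' (y - x)) \<le> e * norm (y - x)"
    using rev[OF zero_less_one] rev[OF half_gt_zero[OF \<open>e > 0\<close>]] W[OF half_gt_zero[OF zero_less_one]] W[OF e4]
  proof eventually_elim
    case (elim y)
    let ?h = "norm (y - x)" and ?w = "norm (W y - W x)"
    have "norm (r y) \<le> (K + 1) * ?h"
      using norm_triangle_ineq[of "r y - r' (y - x)" "r' (y - x)"] elim(1) K(2)[of "y - x"]
      by (simp add: algebra_simps)
    moreover have "?w \<le> norm (W y - W x - r y) + norm (r y)"
      using norm_triangle_ineq[of "W y - W x - r y" "r y"] by simp
    ultimately have w: "?w \<le> 2 * ((K + 1) * ?h)"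
      using elim(3) by linarith
    have "e / (4 * (K + 1)) * ?w \<le> e / (4 * (K + 1)) * (2 * ((K + 1) * ?h))"
      using w K(1) \<open>e > 0\<close> by (intro mult_left_mono) auto
    also have "\<dots> = e / 2 * ?h" using K(1) by (simp add: field_simps)
    finally have "norm (W y - W x - r y) \<le> e / 2 * ?h" using elim(4) by linarith
    moreover have "norm (W y - W x - r' (y - x)) \<le> norm (W y - W x - r y) + norm (r y - r' (y - x))"
      using norm_triangle_ineq[of "W y - W x - r y" "r y - r' (y - x)"] by simp
    ultimately show ?case using elim(2) by linarith
  qed
  then show "\<exists>d>0. \<forall>y. norm (y - x) < d \<longrightarrow> norm (W y - W x - r' (y - x)) \<le> e * norm (y - x)"
    unfolding eventually_nhds_metric by (simp add: dist_norm)
qed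

text \<open>Serves for fields given only by a linear system, such as the shape operator applied to a
  field. With a left inverse \<open>\<Lambda>\<close> of \<open>M x\<close>, the error
  \<open>W y - W x - r y\<close> is the map \<open>w - \<Lambda> (M y w)\<close> applied to the
  increment of \<open>W\<close>, and this map tends to zero as \<open>y\<close> approaches
  \<open>x\<close>.\<close>

lemma differentiable_linear_solution:
  fixes M :: "'a::real_normed_vector \<Rightarrow> 'v::euclidean_space \<Rightarrow> 'w::euclidean_space"
  assumes lin: "\<forall>\<^sub>F y in nhds x. linear (M y)" and inj: "inj (M x)"
    and M: "\<And>v. (\<lambda>y. M y v) differentiable at x" and b: "b differentiable at x"
    and W: "\<forall>\<^sub>F y in nhds x. M y (W y) = b y"
  shows "W differentiable at x"
proof -
  obtain \<Lambda> where \<Lambda>: "linear \<Lambda>" "\<And>w. \<Lambda> (M x w) = w"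
    using linear_injective_left_inverse[OF eventually_nhds_x_imp_x[OF lin] inj]
    by (auto simp: fun_eq_iff)
  have bl: "bounded_linear \<Lambda>" using \<Lambda>(1) by (simp add: linear_conv_bounded_linear)
  define r where "r y = \<Lambda> (b y - M y (W x))" for y
  have "(\<lambda>y. b y - M y (W x)) differentiable at x"
    using M b by (intro differentiable_diff)
  then obtain r' where r': "(r has_derivative r') (at x)"
    unfolding r_def differentiable_def using bounded_linear.has_derivative[OF bl] by blast
  have r0: "r x = 0"
    using eventually_nhds_x_imp_x[OF W] \<Lambda>(1) by (simp add: r_def linear_0)
  have "\<forall>\<^sub>F y in nhds x. norm (W y - W x - r y) \<le> e * norm (W y - W x)" if "e > 0" for e
  proof -
    define s where "s y = (\<Sum>a\<in>Basis. norm (a - \<Lambda> (M y a)))" for y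
    have "isCont (\<lambda>y. \<Lambda> (M y a)) x" for a
      using differentiable_imp_continuous_within[OF M] bounded_linear.continuous[OF bl] by blast
    then have "isCont s x" unfolding s_def by (intro continuous_intros) auto
    then have "(s \<longlongrightarrow> s x) (nhds x)"
      by (simp add: continuous_at tendsto_at_iff_tendsto_nhds)
    moreover have "s x = 0" by (simp add: s_def \<Lambda>)
    ultimately have "\<forall>\<^sub>F y in nhds x. s y < e"
      using order_tendstoD(2)[of s "s x" "nhds x" e] that by simp
    then show ?thesis using lin W
    proof eventually_elim
      case (elim y)
      let ?w = "W y - W x"
      have lN: "linear (\<lambda>w. w - \<Lambda> (M y w))"
        using linear_compose[OF elim(2) \<Lambda>(1)] by (intro linear_compose_sub linear_ident) (simp add: o_def)
      have "W y - W x - r y = ?w - \<Lambda> (M y ?w)"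
        using elim(2,3) by (simp add: r_def linear_diff)
      also have "\<dots> = (\<Sum>a\<in>Basis. (?w \<bullet> a) *\<^sub>R (a - \<Lambda> (M y a)))"
        by (rule linear_eq_sum_Basis[OF lN])
      also have "norm \<dots> \<le> (\<Sum>a\<in>Basis. norm ?w * norm (a - \<Lambda> (M y a)))"
        by (rule sum_norm_le) (simp add: mult_right_mono Basis_le_norm)
      also have "\<dots> \<le> e * norm ?w"
        using elim(1) mult_left_mono[of "s y" e "norm ?w"]
        by (simp add: s_def mult.commute flip: sum_distrib_left)
      finally show ?case .
    qed
  qed
  from has_derivative_implicit[OF r' r0 this] show ?thesis by (auto simp: differentiable_def)
qed

text \<open>A continuous map is differentiable once its composite with an immersion is. Continuity
  brings \<open>l y\<close> into the region where the linearization of \<open>\<tau>\<close> is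
  accurate, and a left inverse of \<open>D \<tau> (l x)\<close> solves for \<open>l\<close>.\<close>

lemma differentiable_left_factor:
  fixes \<tau> :: "'v::euclidean_space \<Rightarrow> 'w::euclidean_space" and l :: "'a::real_normed_vector \<Rightarrow> 'v"
  assumes \<tau>: "\<tau> differentiable at (l x)" and inj: "inj (D \<tau> (l x))" and l: "isCont l x"
    and \<phi>: "\<phi> differentiable at x" and eq: "\<forall>\<^sub>F y in nhds x. \<tau> (l y) = \<phi> y"
  shows "l differentiable at x"
proof -
  obtain \<Lambda> where \<Lambda>: "linear \<Lambda>" "\<And>w. \<Lambda> (D \<tau> (l x) w) = w"
    using linear_injective_left_inverse[OF linear_D[OF \<tau>] inj] by (auto simp: fun_eq_iff)
  have bl: "bounded_linear \<Lambda>" using \<Lambda>(1) by (simp add: linear_conv_bounded_linear)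
  then obtain K where K: "K > 0" "\<And>h. norm (\<Lambda> h) \<le> norm h * K"
    using bounded_linear.pos_bounded by blast
  define r where "r y = \<Lambda> (\<phi> y - \<phi> x)" for y
  have "(\<lambda>y. \<phi> y - \<phi> x) differentiable at x"
    using \<phi> by (intro differentiable_diff differentiable_const)
  then obtain r' where r': "(r has_derivative r') (at x)"
    unfolding r_def differentiable_def using bounded_linear.has_derivative[OF bl] by blast
  have r0: "r x = 0" using \<Lambda>(1) by (simp add: r_def linear_0)
  have "\<forall>\<^sub>F y in nhds x. norm (l y - l x - r y) \<le> e * norm (l y - l x)" if "e > 0" for e
  proof -
    have "\<forall>\<^sub>F z in nhds (l x). norm (\<tau> z - \<tau> (l x) - D \<tau> (l x) (z - l x)) \<le> e / K * norm (z - l x)"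
      using D_works[OF \<tau>] divide_pos_pos[OF that K(1)]
      unfolding has_derivative_at_alt eventually_nhds_metric dist_norm by blast
    moreover have "filterlim l (nhds (l x)) (nhds x)"
      using l by (simp add: continuous_at tendsto_at_iff_tendsto_nhds)
    ultimately have "\<forall>\<^sub>F y in nhds x. norm (\<tau> (l y) - \<tau> (l x) - D \<tau> (l x) (l y - l x)) \<le> e / K * norm (l y - l x)"
      by (rule eventually_compose_filterlim)
    then show ?thesis using eq
    proof eventually_elim
      case (elim y)
      have "l y - l x - r y = - \<Lambda> (\<tau> (l y) - \<tau> (l x) - D \<tau> (l x) (l y - l x))"
        using elim(2) eventually_nhds_x_imp_x[OF eq] \<Lambda> by (simp add: r_def linear_diff)
      also have "norm \<dots> \<le> norm (\<tau> (l y) - \<tau> (l x) - D \<tau> (l x) (l y - l x)) * K"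
        by (simp only: norm_minus_cancel K(2))
      also have "\<dots> \<le> (e / K * norm (l y - l x)) * K"
        using elim(1) K(1) by (intro mult_right_mono) auto
      finally show ?case using K(1) by simp
    qed
  qed
  from has_derivative_implicit[OF r' r0 this] show ?thesis by (auto simp: differentiable_def)
qed


section \<open>Metrics at a point\<close>

text \<open>Dimension count: \<open>range T\<close> lies in the orthogonal complement of
  \<open>B\<close> and has the same dimension. It is applied with two real normals for hypersurfaces
  and with four for the cone over the quadric.\<close>

lemma orthogonal_complement_subset_range:
  fixes T :: "'v::euclidean_space \<Rightarrow> 'w::euclidean_space"
  assumes T: "linear T" "inj T"
    and B: "finite B" "pairwise orthogonal B" "0 \<notin> B" "card B + DIM('v) = DIM('w)"
    and BT: "\<And>b v. b \<in> B \<Longrightarrow> b \<bullet> T v = 0" and w: "\<And>b. b \<in> B \<Longrightarrow> b \<bullet> w = 0"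
  shows "w \<in> range T"
proof -
  define S where "S = {y \<in> UNIV. \<forall>x\<in>span B. orthogonal x y}"
  have "dim S + dim (span B) = dim (UNIV :: 'w set)"
    unfolding S_def by (rule dim_subspace_orthogonal_to_vectors) auto
  moreover have "dim (span B) = card B"
    using B(2,3) by (simp add: dim_eq_card_independent pairwise_orthogonal_independent)
  moreover have "dim (range T) = DIM('v)"
    using dim_image_eq[OF T(1), of UNIV] T(2) by simp
  ultimately have dim: "dim S \<le> dim (range T)"
    using B(4) by simp
  have perp: "y \<in> S" if "\<And>b. b \<in> B \<Longrightarrow> b \<bullet> y = 0" for y
  proof -
    have "x \<bullet> y = 0" if "x \<in> span B" for x
      using that by (induction rule: span_induct) (auto simp: subspace_def inner_add_left \<open>\<And>b. b \<in> B \<Longrightarrow> b \<bullet> y = 0\<close>)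
    then show ?thesis by (simp add: S_def orthogonal_def)
  qed
  have "subspace S"
    unfolding S_def by (auto simp: subspace_def orthogonal_def inner_add_right)
  then have "range T = S"
    using dim perp[OF BT] T(1)
    by (intro subspace_dim_equal) (auto intro: linear_subspace_image)
  then show ?thesis using perp[OF w] by simp
qed

text \<open>Nondegeneracy makes \<open>S\<close>, which converts \<open>G\<close> to the Euclidean
  product, injective; in finite dimension it is then onto.\<close>

lemma nondegenerate_representation:
  fixes G :: "'v::euclidean_space \<Rightarrow> 'v \<Rightarrow> real"
  assumes G: "bilinear G" "\<And>u. (\<And>v. G u v = 0) \<Longrightarrow> u = 0" and \<phi>: "linear \<phi>"
  shows "\<exists>a. \<forall>v. G a v = \<phi> v"
proof -
  define S where "S a = (\<Sum>b\<in>Basis. G a b *\<^sub>R b)" for a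
  have rep: "\<psi> v = (\<Sum>b\<in>Basis. \<psi> b *\<^sub>R b) \<bullet> v" if "linear \<psi>" for \<psi> :: "'v \<Rightarrow> real" and v
    by (subst linear_eq_sum_Basis[OF that]) (simp add: inner_sum_left inner_commute[of v] mult.commute)
  have S: "G a v = S a \<bullet> v" for a v
    unfolding S_def by (rule rep) (use G(1) in \<open>simp add: bilinear_def\<close>)
  have "linear S"
    unfolding S_def
    by (rule linearI) (simp_all add: bilinear_ladd[OF G(1)] bilinear_lmul[OF G(1)] scaleR_add_left
        sum.distrib scaleR_sum_right)
  moreover have "inj S"
    unfolding linear_injective_0[OF \<open>linear S\<close>] using G(2) S by simp
  ultimately have "surj S"
    by (rule linear_inj_imp_surj)
  then obtain a where a: "(\<Sum>b\<in>Basis. \<phi> b *\<^sub>R b) = S a"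
    by (rule surjE)
  then show ?thesis using rep[OF \<phi>, unfolded a] S by auto
qed

text \<open>The hypothesis on the derivative of the metric is Koszul's formula in disguise: a trilinear \<open>H\<close>,
  symmetric in its first two arguments, is determined by the sum on the right-hand side.\<close>

lemma
  fixes G :: "'v::euclidean_space metric_field"
  assumes G: "bilinear (G x)" "\<And>u v. G x u v = G x v u" "\<And>u. (\<And>v. G x u v = 0) \<Longrightarrow> u = 0"
    and H: "\<And>v w. linear (\<lambda>u. H u v w)" "\<And>u v. linear (H u v)" "\<And>u v w. H u v w = H v u w"
    and dG: "\<And>u v w. D (\<lambda>y. G y u v) x w = H w u v + H w v u"
  shows bilinear_levi_civita: "bilinear (levi_civita G x)"
    and levi_civita_metric: "G x (levi_civita G x u v) w = H u v w"
proof -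
  have "\<exists>a. \<forall>w. G x a w = H u v w" for u v
    by (rule nondegenerate_representation[OF G(1,3) H(2)])
  then obtain \<Gamma> where \<Gamma>: "\<And>u v w. G x (\<Gamma> u v) w = H u v w"
    by metis
  have eqI: "a = b" if "\<And>w. G x a w = G x b w" for a b
    using G(3)[of "a - b"] that by (simp add: bilinear_lsub[OF G(1)])
  have H': "linear (\<lambda>v. H u v w)" for u w
    using H(1)[of u w] by (subst H(3))
  have bil: "bilinear \<Gamma>"
    unfolding bilinear_def
  proof (intro conjI allI linearI)
    show "\<Gamma> u (v + v') = \<Gamma> u v + \<Gamma> u v'" for u v v'
      by (rule eqI) (simp add: bilinear_ladd[OF G(1)] \<Gamma> linear_add[OF H'])
    show "\<Gamma> u (a *\<^sub>R v) = a *\<^sub>R \<Gamma> u v" for u v a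
      by (rule eqI) (simp add: bilinear_lmul[OF G(1)] \<Gamma> linear_cmul[OF H'])
    show "\<Gamma> (v + v') u = \<Gamma> v u + \<Gamma> v' u" for u v v'
      by (rule eqI) (simp add: bilinear_ladd[OF G(1)] \<Gamma> linear_add[OF H(1)])
    show "\<Gamma> (a *\<^sub>R v) u = a *\<^sub>R \<Gamma> v u" for u v a
      by (rule eqI) (simp add: bilinear_lmul[OF G(1)] \<Gamma> linear_cmul[OF H(1)])
  qed
  have "levi_civita G x = \<Gamma>"
    unfolding levi_civita_def
  proof (rule the_equality)
    have "\<Gamma> u v = \<Gamma> v u" for u v
      by (rule eqI) (simp add: \<Gamma> H(3)[of u v])
    moreover have "D (\<lambda>y. G y u v) x w = G x (\<Gamma> w u) v + G x u (\<Gamma> w v)" for w u v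
      using G(2)[of u] by (simp add: dG \<Gamma>)
    ultimately show "bilinear \<Gamma> \<and> (\<forall>u v. \<Gamma> u v = \<Gamma> v u) \<and>
        (\<forall>w u v. D (\<lambda>y. G y u v) x w = G x (\<Gamma> w u) v + G x u (\<Gamma> w v))"
      using bil by blast
  next
    fix \<Delta> assume \<Delta>: "bilinear \<Delta> \<and> (\<forall>u v. \<Delta> u v = \<Delta> v u) \<and>
        (\<forall>w u v. D (\<lambda>y. G y u v) x w = G x (\<Delta> w u) v + G x u (\<Delta> w v))"
    define E where "E u v w = G x (\<Delta> u v) w - H u v w" for u v w
    have sym: "E u v w = E v u w" for u v w
      using \<Delta> H(3) by (simp add: E_def)
    have skew: "E u v w = - E u w v" for u v w
      using \<Delta> dG[of v w u] G(2)[of v] by (simp add: E_def)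
    \<comment> \<open>The tensor \<open>E\<close> is symmetric in its first two slots and
      antisymmetric in its last two; running through the permutations gives
      \<open>E = - E\<close>.\<close>
    have "E u v w = 0" for u v w
      using skew[of u v w] skew[of w u v] skew[of v w u] sym[of u v w] sym[of u w v] sym[of v w u]
      by linarith
    then show "\<Delta> = \<Gamma>"
      by (intro ext eqI) (simp add: E_def \<Gamma>)
  qed
  then show "bilinear (levi_civita G x)" "G x (levi_civita G x u v) w = H u v w"
    using bil \<Gamma> by simp_all
qed

text \<open>The tangential part exists because the pullback of a positive definite metric under an
  injective map is nondegenerate. Two candidates for the normal part differ by a vector that is both
  normal and tangential.\<close>

lemma
  fixes G :: "'w::euclidean_space metric_field" and f :: "'v::euclidean_space \<Rightarrow> 'w"
  assumes G: "bilinear (G (f x))" "\<And>u v. G (f x) u v = G (f x) v u" "\<And>u. u \<noteq> 0 \<Longrightarrow> G (f x) u u > 0"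
    and f: "linear (D f x)" "inj (D f x)"
  shows normal_part_orthogonal: "G (f x) (normal_part G f x w) (D f x u) = 0"
    and normal_part_tangential: "w - normal_part G f x w \<in> range (D f x)"
proof -
  let ?G = "G (f x)" and ?L = "D f x"
  have "bilinear (\<lambda>u v. ?G (?L u) (?L v))"
    unfolding bilinear_def
    by (intro conjI allI linearI)
      (simp_all add: linear_add[OF f(1)] linear_cmul[OF f(1)] bilinear_ladd[OF G(1)]
        bilinear_radd[OF G(1)] bilinear_lmul[OF G(1)] bilinear_rmul[OF G(1)])
  moreover have "u = 0" if "\<And>v. ?G (?L u) (?L v) = 0" for u
    using that[of u] G(3)[of "?L u"] linear_injective_0[OF f(1)] f(2) by (cases "?L u = 0") auto
  moreover have "linear (\<lambda>v. ?G w (?L v))"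
    by (intro linearI) (simp_all add: linear_add[OF f(1)] linear_cmul[OF f(1)]
        bilinear_radd[OF G(1)] bilinear_rmul[OF G(1)])
  ultimately obtain a where a: "\<And>v. ?G (?L a) (?L v) = ?G w (?L v)"
    using nondegenerate_representation[of "\<lambda>u v. ?G (?L u) (?L v)"] by blast
  let ?P = "\<lambda>n. (\<forall>u. ?G n (?L u) = 0) \<and> w - n \<in> range ?L"
  have "?P (w - ?L a)"
    using a by (auto simp: bilinear_lsub[OF G(1)])
  moreover have "n = m" if nm: "?P n" "?P m" for n m
  proof -
    obtain b where "w - n = ?L b" using nm(1) by blast
    moreover obtain c where "w - m = ?L c" using nm(2) by blast
    ultimately have bc: "w - n = ?L b" "w - m = ?L c" .
    then have "m - n = ?L (b - c)"
      by (simp add: linear_diff[OF f(1)] algebra_simps flip: bc)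
    then have "?G (m - n) (m - n) = ?G (m - n) (?L (b - c))" by (rule arg_cong)
    also have "\<dots> = 0" using nm by (simp add: bilinear_lsub[OF G(1)])
    finally have "?G (m - n) (m - n) = 0" .
    then show ?thesis using G(3)[of "m - n"] by force
  qed
  ultimately have "\<exists>!n. ?P n" by blast
  then have "?P (normal_part G f x w)"
    unfolding normal_part_def by (rule theI')
  then show "?G (normal_part G f x w) (?L u) = 0" "w - normal_part G f x w \<in> range ?L"
    by blast+
qed

text \<open>Pairing with a normal \<open>N\<close> does not see the tangential part, so the
  projection onto the normal space drops out and only the covariant derivative along
  \<open>f\<close> remains.\<close>

lemma pullback_normal_shape_op:
  fixes G :: "'w::euclidean_space metric_field" and f :: "'v::euclidean_space \<Rightarrow> 'w"
  assumes G: "bilinear (G (f x))" "\<And>u v. G (f x) u v = G (f x) v u" "\<And>u. u \<noteq> 0 \<Longrightarrow> G (f x) u u > 0"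
    and \<Gamma>: "bilinear (levi_civita G (f x))"
    and f: "twice_differentiable_at f x" "inj (D f x)"
    and N: "\<And>u. G (f x) (D f x u) N = 0"
  shows "pullback G f x (normal_shape_op G f x N u) v =
    G (f x) (D2 f x u v + levi_civita G (f x) (D f x u) (D f x v)) N"
proof -
  let ?G = "G (f x)" and ?L = "D f x"
  define \<phi> where "\<phi> v = ?G (D2 f x u v + levi_civita G (f x) (?L u) (?L v)) N" for v
  have lin: "linear ?L" by (rule linear_D[OF differentiable_at_if_twice[OF f(1)]])
  have II: "?G (second_ff G f (\<lambda>_. u) (\<lambda>_. v) x) N = \<phi> v" for v
  proof -
    let ?n = "nabla_along G f (\<lambda>_. u) (\<lambda>_. v) x"
    obtain b where "?n - normal_part G f x ?n = ?L b"
      using normal_part_tangential[where G = G, OF G lin f(2), of ?n] by blast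
    then have "?G (?n - normal_part G f x ?n) N = 0" using N by simp
    then show ?thesis
      by (simp add: second_ff_def bilinear_lsub[OF G(1)] \<phi>_def nabla_along_def D2_def)
  qed
  have bil: "bilinear (pullback G f x)"
    unfolding bilinear_def pullback_def
    by (intro conjI allI linearI)
      (simp_all add: linear_add[OF lin] linear_cmul[OF lin] bilinear_ladd[OF G(1)]
        bilinear_radd[OF G(1)] bilinear_lmul[OF G(1)] bilinear_rmul[OF G(1)])
  have nondeg: "u = 0" if "\<And>v. pullback G f x u v = 0" for u
    using that[of u] G(3)[of "?L u"] linear_injective_0[OF lin] f(2)
    by (cases "?L u = 0") (auto simp: pullback_def)
  have "linear \<phi>"
    unfolding \<phi>_def
    by (intro linearI) (simp_all add: linear_add[OF lin] linear_cmul[OF lin] bilinear_ladd[OF G(1)]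
        bilinear_lmul[OF G(1)] bilinear_radd[OF \<Gamma>] bilinear_rmul[OF \<Gamma>]
        bilinear_radd[OF bilinear_D2[OF f(1)]] bilinear_rmul[OF bilinear_D2[OF f(1)]] distrib_left)
  then obtain a where a: "\<And>v. pullback G f x a v = \<phi> v"
    using nondegenerate_representation[OF bil nondeg] by blast
  have "normal_shape_op G f x N u = a"
    unfolding normal_shape_op_def
  proof (rule the_equality)
    show "\<forall>v. pullback G f x a v = ?G (second_ff G f (\<lambda>_. u) (\<lambda>_. v) x) N"
      using a II by simp
  next
    fix b assume "\<forall>v. pullback G f x b v = ?G (second_ff G f (\<lambda>_. u) (\<lambda>_. v) x) N"
    then have "pullback G f x (b - a) v = 0" for v
      by (simp add: bilinear_lsub[OF bil] a II)
    then show "b = a" using nondeg[of "b - a"] by simp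
  qed
  then show ?thesis using a by (simp add: \<phi>_def)
qed


section \<open>Hypersurfaces\<close>

definition cubic_form :: "('v::euclidean_space \<Rightarrow> 'a::euclidean_space) \<Rightarrow> ('v \<Rightarrow> 'a) \<Rightarrow> 'v \<Rightarrow> 'v \<Rightarrow> 'v \<Rightarrow> 'v \<Rightarrow> real" where
  "cubic_form f \<nu> x u v w = D2 f x u v \<bullet> D \<nu> x w - D2 \<nu> x u v \<bullet> D f x w"

lemma D_inner:
  assumes "f differentiable at x" "g differentiable at x"
  shows "D (\<lambda>y. f y \<bullet> g y) x v = f x \<bullet> D g x v + D f x v \<bullet> g x"
  by (rule D_bilinear[OF bounded_bilinear_inner assms])

lemma cubic_form_commute:
  assumes "twice_differentiable_at f x" "twice_differentiable_at \<nu> x"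
  shows "cubic_form f \<nu> x u v w = cubic_form f \<nu> x v u w"
  using D2_symmetric[OF assms(1), of u v] D2_symmetric[OF assms(2), of u v]
  by (simp add: cubic_form_def)

text \<open>Isolates the contact condition \<open>\<nu> y \<bullet> D f y u = 0\<close>, which is
  the source of both symmetries below and is shared by all parallel pairs.\<close>

locale hypersurface_patch =
  fixes U :: "'v::euclidean_space set" and f \<nu> :: "'v \<Rightarrow> 'a::euclidean_space"
  assumes open_U: "open U"
    and twice_f: "y \<in> U \<Longrightarrow> twice_differentiable_at f y"
    and twice_\<nu>: "y \<in> U \<Longrightarrow> twice_differentiable_at \<nu> y"
    and normal: "y \<in> U \<Longrightarrow> \<nu> y \<bullet> D f y u = 0"
begin

lemma eventually_U: "x \<in> U \<Longrightarrow> \<forall>\<^sub>F y in nhds x. y \<in> U"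
  using open_U by (rule eventually_nhds_in_open)

lemma D_eq_zero: "(\<And>y. y \<in> U \<Longrightarrow> h y = c) \<Longrightarrow> x \<in> U \<Longrightarrow> D h x u = 0"
  using D_cong_nhds[of h "\<lambda>_. c" x] eventually_U[of x] by (simp add: eventually_mono)

text \<open>Differentiating \<open>\<nu> \<bullet> D f v = 0\<close> along \<open>u\<close>
  expresses the shape form through \<open>\<nu> \<bullet> D2 f u v\<close>, so symmetry comes from
  that of \<open>D2 f\<close>.\<close>

lemma shape_form_symmetric:
  assumes x: "x \<in> U"
  shows "D \<nu> x u \<bullet> D f x v = D \<nu> x v \<bullet> D f x u"
proof -
  have "\<nu> x \<bullet> D2 f x u v + D \<nu> x u \<bullet> D f x v = 0" for u v
    using D_inner[OF differentiable_at_if_twice[OF twice_\<nu>[OF x]] twice_differentiable_atD[OF twice_f[OF x]]]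
      D_eq_zero[of "\<lambda>y. \<nu> y \<bullet> D f y v" 0 x u] normal x by (simp add: D2_def)
  from this[of u v] this[of v u] show ?thesis
    using D2_symmetric[OF twice_f[OF x], of u v] by simp
qed

text \<open>The Codazzi equation in disguise: the antisymmetric part of the shape form vanishes
  identically, and its derivative along \<open>u\<close> is the difference of the two cubic
  forms.\<close>

lemma cubic_form_commute_right:
  assumes x: "x \<in> U"
  shows "cubic_form f \<nu> x u v w = cubic_form f \<nu> x u w v"
proof -
  have "((\<lambda>y. D \<nu> y w \<bullet> D f y v - D \<nu> y v \<bullet> D f y w) has_derivative (\<lambda>u.
      (D \<nu> x w \<bullet> D2 f x u v + D2 \<nu> x u w \<bullet> D f x v) - (D \<nu> x v \<bullet> D2 f x u w + D2 \<nu> x u v \<bullet> D f x w))) (at x)"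
    by (intro has_derivative_diff has_derivative_inner has_derivative_D twice_f twice_\<nu> x)
  from fun_cong[OF D_eqI[OF this], of u]
  have "D (\<lambda>y. D \<nu> y w \<bullet> D f y v - D \<nu> y v \<bullet> D f y w) x u =
      cubic_form f \<nu> x u v w - cubic_form f \<nu> x u w v"
    by (simp add: cubic_form_def inner_commute algebra_simps)
  moreover have "D (\<lambda>y. D \<nu> y w \<bullet> D f y v - D \<nu> y v \<bullet> D f y w) x u = 0"
    by (rule D_eq_zero[OF _ x, of _ 0]) (simp add: shape_form_symmetric[of _ v w])
  ultimately show ?thesis by simp
qed

end

text \<open>Tangentiality of \<open>D \<nu>\<close> makes the shape operator exist. It is an
  assumption here because its proof belongs to the sphere: \<open>immersed_parallel\<close> obtains
  it from the codimension.\<close>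

locale immersed_patch = hypersurface_patch U f \<nu>
  for U :: "'v::euclidean_space set" and f \<nu> :: "'v \<Rightarrow> 'a::euclidean_space" +
  assumes immersion: "y \<in> U \<Longrightarrow> inj (D f y)"
    and D_normal_tangential: "y \<in> U \<Longrightarrow> D \<nu> y u \<in> range (D f y)"
begin

lemma linear_D_f: "y \<in> U \<Longrightarrow> linear (D f y)"
  by (rule linear_D[OF differentiable_at_if_twice[OF twice_f]])

lemma D_shape_op: "y \<in> U \<Longrightarrow> D f y (shape_op f \<nu> y u) = - D \<nu> y u"
proof -
  assume y: "y \<in> U"
  obtain w where "D \<nu> y u = D f y w"
    using D_normal_tangential[OF y, of u] by blast
  then have w: "D \<nu> y u = - D f y (- w)"
    by (simp add: linear_neg[OF linear_D_f[OF y]])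
  have "shape_op f \<nu> y u = - w"
    unfolding shape_op_def
  proof (rule the_equality)
    show "D \<nu> y u = - D f y (- w)" by (rule w)
    show "w' = - w" if "D \<nu> y u = - D f y w'" for w'
      using that w injD[OF immersion[OF y]] by simp
  qed
  then show ?thesis using w by simp
qed

text \<open>The product rule for \<open>D f u \<bullet> D f v\<close> exhibits
  \<open>D2 f u v \<bullet> D f w\<close> as the Christoffel symbols of the first kind.\<close>

lemma levi_civita_induced_metric:
  assumes x: "x \<in> U"
  shows "induced_metric f x (levi_civita (induced_metric f) x u v) w = D2 f x u v \<bullet> D f x w"
proof (rule levi_civita_metric[where H = "\<lambda>u v w. D2 f x u v \<bullet> D f x w"])
  note lin = linear_D_f[OF x] and bil = bilinear_D2[OF twice_f[OF x]]
  show "bilinear (induced_metric f x)"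
    unfolding bilinear_def induced_metric_def
    by (intro conjI allI linearI)
      (simp_all add: linear_add[OF lin] linear_cmul[OF lin] inner_add_left inner_add_right)
  show "induced_metric f x u v = induced_metric f x v u" for u v
    by (simp add: induced_metric_def inner_commute)
  show "u = 0" if "\<And>v. induced_metric f x u v = 0" for u
    using that[of u] immersion[OF x] linear_injective_0[OF lin] by (simp add: induced_metric_def)
  show "linear (\<lambda>u. D2 f x u v \<bullet> D f x w)" for v w
    by (rule linearI) (simp_all add: bilinear_ladd[OF bil] bilinear_lmul[OF bil] inner_add_left)
  show "linear (\<lambda>w. D2 f x u v \<bullet> D f x w)" for u v
    by (rule linearI) (simp_all add: linear_add[OF lin] linear_cmul[OF lin] inner_add_right)
  show "D2 f x u v \<bullet> D f x w = D2 f x v u \<bullet> D f x w" for u v w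
    by (simp add: D2_symmetric[OF twice_f[OF x], of u v])
  show "D (\<lambda>y. induced_metric f y u v) x w = D2 f x w u \<bullet> D f x v + D2 f x w v \<bullet> D f x u" for u v w
    using D_inner[OF twice_differentiable_atD[OF twice_f[OF x]] twice_differentiable_atD[OF twice_f[OF x]], of u v w]
    by (simp add: induced_metric_def D2_def inner_commute)
qed

lemma nabla_induced_metric:
  assumes x: "x \<in> U" and W: "W differentiable at x"
  shows "induced_metric f x (nabla (induced_metric f) X W x) w = D (\<lambda>y. D f y (W y)) x (X x) \<bullet> D f x w"
proof -
  have "D (\<lambda>y. D f y (W y)) x (X x) = D2 f x (X x) (W x) + D f x (D W x (X x))"
    using D_eqI[OF has_derivative_D_field[of f "\<lambda>y. y", OF twice_f[OF x] differentiable_ident W]] by simp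
  moreover have "induced_metric f x (nabla (induced_metric f) X W x) w =
      D f x (D W x (X x)) \<bullet> D f x w + induced_metric f x (levi_civita (induced_metric f) x (X x) (W x)) w"
    by (simp add: nabla_def induced_metric_def linear_add[OF linear_D_f[OF x]] inner_add_left)
  ultimately show ?thesis
    using levi_civita_induced_metric[OF x] by (simp add: inner_add_left)
qed

text \<open>Differentiating \<open>D f (A Y) = - D \<nu> Y\<close> handles the first term; in the
  second, self-adjointness moves \<open>A\<close> onto \<open>w\<close>. The two contributions of
  \<open>D Y\<close> then cancel by symmetry of the shape form, leaving only second derivatives of
  \<open>f\<close> and \<open>\<nu>\<close>.\<close>

lemma nabla_shape_op:
  assumes x: "x \<in> U" and Y: "Y differentiable at x"
  shows "induced_metric f x (nabla (induced_metric f) X (\<lambda>y. shape_op f \<nu> y (Y y)) x -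
      shape_op f \<nu> x (nabla (induced_metric f) X Y x)) w = cubic_form f \<nu> x (X x) (Y x) w"
proof -
  let ?A = "shape_op f \<nu>" and ?G = "induced_metric f" and ?X = "X x"
  let ?W = "\<lambda>y. ?A y (Y y)" and ?N = "nabla ?G X Y x"
  have \<nu>Y: "((\<lambda>y. D \<nu> y (Y y)) has_derivative (\<lambda>u. D2 \<nu> x u (Y x) + D \<nu> x (D Y x u))) (at x)"
    using has_derivative_D_field[of \<nu> "\<lambda>y. y", OF twice_\<nu>[OF x] differentiable_ident Y] by simp
  have ev: "\<forall>\<^sub>F y in nhds x. D f y (?W y) = - D \<nu> y (Y y)"
    using eventually_U[OF x] by eventually_elim (rule D_shape_op)
  have "?W differentiable at x"
  proof (rule differentiable_linear_solution)
    show "\<forall>\<^sub>F y in nhds x. linear (D f y)"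
      using eventually_U[OF x] by eventually_elim (rule linear_D_f)
    show "(\<lambda>y. - D \<nu> y (Y y)) differentiable at x"
      using differentiableI[OF \<nu>Y] by (rule differentiable_minus)
  qed (use immersion x twice_differentiable_atD[OF twice_f[OF x]] ev in auto)
  then have "?G x (nabla ?G X ?W x) w = D (\<lambda>y. D f y (?W y)) x ?X \<bullet> D f x w"
    by (rule nabla_induced_metric[OF x])
  also have "\<dots> = - (D2 \<nu> x ?X (Y x) + D \<nu> x (D Y x ?X)) \<bullet> D f x w"
    using D_eqI[OF has_derivative_minus[OF \<nu>Y]] by (simp add: D_cong_nhds[OF ev])
  finally have 1: "?G x (nabla ?G X ?W x) w = - (D2 \<nu> x ?X (Y x) + D \<nu> x (D Y x ?X)) \<bullet> D f x w" .
  have "?G x (?A x ?N) w = - D \<nu> x ?N \<bullet> D f x w"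
    by (simp add: induced_metric_def D_shape_op[OF x])
  also have "\<dots> = D f x (?A x w) \<bullet> D f x ?N"
    using shape_form_symmetric[OF x, of ?N w] by (simp add: D_shape_op[OF x])
  also have "\<dots> = D (\<lambda>y. D f y (Y y)) x ?X \<bullet> D f x (?A x w)"
    using nabla_induced_metric[OF x Y, of X "?A x w"] by (simp add: induced_metric_def inner_commute)
  also have "D (\<lambda>y. D f y (Y y)) x ?X = D2 f x ?X (Y x) + D f x (D Y x ?X)"
    using D_eqI[OF has_derivative_D_field[of f "\<lambda>y. y", OF twice_f[OF x] differentiable_ident Y]] by simp
  finally have 2: "?G x (?A x ?N) w = - (D2 f x ?X (Y x) + D f x (D Y x ?X)) \<bullet> D \<nu> x w"
    by (simp add: D_shape_op[OF x] inner_add_left inner_diff_left)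
  have "?G x (nabla ?G X ?W x - ?A x ?N) w = ?G x (nabla ?G X ?W x) w - ?G x (?A x ?N) w"
    by (simp add: induced_metric_def linear_diff[OF linear_D_f[OF x]] inner_diff_left)
  then show ?thesis
    using 1 2 shape_form_symmetric[OF x, of "D Y x ?X" w]
    by (simp add: cubic_form_def inner_add_left inner_diff_left inner_commute[of _ "D \<nu> x w"] algebra_simps)
qed

end


section \<open>Complex vectors\<close>

lemma bounded_bilinear_vector_scalar_mult: "bounded_bilinear ((*s) :: complex \<Rightarrow> complex^'k \<Rightarrow> complex^'k)"
  unfolding bilinear_conv_bounded_bilinear[symmetric] bilinear_def
  by (intro conjI allI linearI) (simp_all add: vec_eq_iff algebra_simps)

lemma hermitian_simps:
  "hermitian (z + z') w = hermitian z w + hermitian z' w"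
  "hermitian z (w + w') = hermitian z w + hermitian z w'"
  "hermitian (z - z') w = hermitian z w - hermitian z' w"
  "hermitian (- z) w = - hermitian z w"
  "hermitian z (- w) = - hermitian z w"
  "hermitian (a *s z) w = a * hermitian z w"
  "hermitian z (a *s w) = cnj a * hermitian z w"
  "hermitian (r *\<^sub>R z) w = r *\<^sub>R hermitian z w"
  "hermitian z (r *\<^sub>R w) = r *\<^sub>R hermitian z w"
  "hermitian 0 w = 0"
  "hermitian z 0 = 0"
  by (simp_all add: hermitian_def sum.distrib sum_distrib_left sum_subtractf sum_negf
      scaleR_sum_right algebra_simps)

lemma bounded_bilinear_hermitian: "bounded_bilinear (hermitian :: complex^'k \<Rightarrow> complex^'k \<Rightarrow> complex)"
  unfolding bilinear_conv_bounded_bilinear[symmetric] bilinear_def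
  by (intro conjI allI linearI) (simp_all add: hermitian_simps)

lemma inner_eq_Re_hermitian: "z \<bullet> w = Re (hermitian z w)"
  by (simp add: hermitian_def inner_vec_def inner_complex_def)

lemma hermitian_commute: "hermitian w z = cnj (hermitian z w)"
  by (simp add: hermitian_def mult.commute)

lemma hermitian_self: "hermitian z z = of_real ((norm z)\<^sup>2)"
proof (rule complex_eqI)
  show "Re (hermitian z z) = Re (of_real ((norm z)\<^sup>2))"
    by (simp add: power2_norm_eq_inner inner_eq_Re_hermitian)
  show "Im (hermitian z z) = Im (of_real ((norm z)\<^sup>2))"
    using arg_cong[OF hermitian_commute[of z z], of Im] by simp
qed

lemma horizontal_simps:
  "horizontal z (v + w) = horizontal z v + horizontal z w"
  "horizontal z (a *s v) = a *s horizontal z v"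
  "hermitian v z = 0 \<Longrightarrow> horizontal z v = v"
  by (simp_all add: horizontal_def hermitian_simps vec_eq_iff add_divide_distrib algebra_simps)

lemma horizontal_self: "z \<noteq> 0 \<Longrightarrow> horizontal z z = 0"
  by (simp add: horizontal_def hermitian_self)

lemma inner_vector_scalar_mult: "(a *s u) \<bullet> (a *s v) = (norm a)\<^sup>2 * (u \<bullet> v)" for u v :: "complex^'k"
  unfolding cmod_power2 by (simp add: inner_eq_Re_hermitian hermitian_simps power2_eq_square algebra_simps)

lemma norm_vector_scalar_mult: "norm (a *s z :: complex^'k) = norm a * norm z"
  by (simp add: norm_eq_sqrt_inner[where 'a = "complex^'k"] inner_vector_scalar_mult real_sqrt_mult)

lemma horizontal_scale: "a \<noteq> 0 \<Longrightarrow> horizontal (a *s z) v = horizontal z v"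
  by (cases "z = 0")
    (simp_all add: horizontal_def hermitian_simps hermitian_self norm_vector_scalar_mult
      power_mult_distrib complex_norm_square[unfolded of_real_power] field_simps)

lemma cproj_eqD:
  assumes "cproj z = cproj w" "z \<noteq> 0"
  obtains a where "a \<noteq> 0" "z = a *s w"
proof -
  have "1 *s z \<in> cproj z" unfolding cproj_def by blast
  then obtain a where "z = a *s w" using assms(1) by (auto simp: cproj_def)
  with assms(2) that show ?thesis by (cases "a = 0") auto
qed

text \<open>The polarization of the quadric's equation, complex bilinear without conjugation.
  Conjugating one argument turns it into the Hermitian product, so tangency to the cone becomes
  orthogonality to \<open>vec_cnj z\<close>.\<close>

definition sum_of_squares_form :: "complex^'k \<Rightarrow> complex^'k \<Rightarrow> complex" where
  "sum_of_squares_form z w = (\<Sum>i\<in>UNIV. z $ i * w $ i)"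

lemma bounded_bilinear_sum_of_squares_form: "bounded_bilinear sum_of_squares_form"
  unfolding bilinear_conv_bounded_bilinear[symmetric] bilinear_def
  by (intro conjI allI linearI)
    (simp_all add: sum_of_squares_form_def sum.distrib scaleR_sum_right algebra_simps)

definition vec_cnj :: "complex^'k \<Rightarrow> complex^'k" where
  "vec_cnj z = (\<chi> i. cnj (z $ i))"

lemma hermitian_vec_cnj: "hermitian z (vec_cnj w) = sum_of_squares_form z w"
  by (simp add: hermitian_def vec_cnj_def sum_of_squares_form_def)

lemma sum_of_squares_form_simps:
  "sum_of_squares_form (a *s z) w = a * sum_of_squares_form z w"
  "sum_of_squares_form z (a *s w) = a * sum_of_squares_form z w"
  "sum_of_squares_form z w = sum_of_squares_form w z"
  by (simp_all add: sum_of_squares_form_def sum_distrib_left algebra_simps)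

lemma quadric_iff:
  assumes "z \<noteq> 0"
  shows "cproj z \<in> quadric \<longleftrightarrow> sum_of_squares_form z z = 0"
proof
  assume "cproj z \<in> quadric"
  then obtain w where w: "cproj z = cproj w" "sum_of_squares_form w w = 0"
    by (auto simp: quadric_def sum_of_squares_form_def power2_eq_square)
  show "sum_of_squares_form z z = 0"
    by (rule cproj_eqD[OF w(1) assms]) (use w(2) in \<open>simp add: sum_of_squares_form_simps(1,2)\<close>)
next
  assume "sum_of_squares_form z z = 0"
  then show "cproj z \<in> quadric"
    using assms by (auto simp: quadric_def sum_of_squares_form_def power2_eq_square)
qed

text \<open>The complex tangent space of the affine cone over the quadric at \<open>z\<close>, intersected with the
  horizontal space, is the Hermitian complement of \<open>z\<close> and its conjugate.\<close>

lemma hermitian_complement_subset_range: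
  fixes T :: "'w::euclidean_space \<Rightarrow> complex^'k"
  assumes T: "linear T" "inj T" and dim: "DIM('w) + 4 = 2 * CARD('k)"
    and z: "norm z = 1" "sum_of_squares_form z z = 0"
    and Tz: "\<And>v. hermitian (T v) z = 0" "\<And>v. sum_of_squares_form (T v) z = 0"
    and w: "hermitian w z = 0" "sum_of_squares_form w z = 0"
  shows "w \<in> range T"
proof -
  \<comment> \<open>A real orthonormal basis of the complex span of \<open>z\<close> and its
    conjugate; these two are orthogonal precisely because \<open>z\<close> satisfies the equation of
    the quadric.\<close>
  let ?B = "{z, \<i> *s z, vec_cnj z, \<i> *s vec_cnj z}"
  have zz: "hermitian z z = 1" "hermitian z (vec_cnj z) = 0" "hermitian (vec_cnj z) z = 0"
    using z by (simp_all add: hermitian_self hermitian_vec_cnj hermitian_commute[of "vec_cnj z"])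
  have cc: "hermitian (vec_cnj z) (vec_cnj z) = 1"
    using zz(1) by (simp add: hermitian_def vec_cnj_def mult.commute)
  note inner = inner_eq_Re_hermitian hermitian_simps zz cc
  have ne: "a \<noteq> b" if "a \<bullet> b = 0" "a \<bullet> a = 1" for a b :: "complex^'k"
    using that by auto
  have "card ?B = 4"
    using ne[of z "\<i> *s z"] ne[of z "vec_cnj z"] ne[of z "\<i> *s vec_cnj z"]
      ne[of "\<i> *s z" "vec_cnj z"] ne[of "\<i> *s z" "\<i> *s vec_cnj z"] ne[of "vec_cnj z" "\<i> *s vec_cnj z"]
    by (simp add: inner)
  moreover have "pairwise orthogonal ?B"
    by (auto simp: pairwise_def orthogonal_def inner)
  moreover have "0 \<notin> ?B"
    using ne[of z 0] ne[of "\<i> *s z" 0] ne[of "vec_cnj z" 0] ne[of "\<i> *s vec_cnj z" 0]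
    by (auto simp: inner eq_commute[of 0])
  moreover have "b \<bullet> v = 0" if "b \<in> ?B" "hermitian v z = 0" "sum_of_squares_form v z = 0" for b v
  proof -
    have "v \<bullet> b = 0"
      using that by (auto simp: inner_eq_Re_hermitian hermitian_simps hermitian_vec_cnj)
    then show ?thesis by (simp add: inner_commute)
  qed
  ultimately show ?thesis
    using dim Tz w by (intro orthogonal_complement_subset_range[OF T, of ?B]) (auto simp: DIM_complex)
qed


section \<open>Normalized lifts of charts of the quadric\<close>

text \<open>Scaling the lift of a chart so that its product with a unit vector \<open>z\<close> over the point \<open>y\<^sub>0\<close> is
  constantly \<open>1\<close> gives an affine chart of projective space, in which the Fubini--Study
  metric is Euclidean to first order at \<open>y\<^sub>0\<close>.\<close>

locale normalized_lift =
  fixes d :: "('w::euclidean_space, (complex^'k) set) chart" and y0 :: 'w and z :: "complex^'k"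
  assumes chart: "is_chart (subtopology cp_topology quadric) d"
    and lift_ex: "\<exists>\<sigma>. is_lift d \<sigma>"
    and dim: "DIM('w) + 4 = 2 * CARD('k)"
    and y0: "y0 \<in> fst d" and z_unit: "norm z = 1" and z: "cproj z = snd d y0"
begin

definition \<sigma> :: "'w \<Rightarrow> complex^'k" where "\<sigma> = lift d"
definition q :: "'w \<Rightarrow> complex" where "q y = hermitian (\<sigma> y) z"
definition V :: "'w set" where "V = {y \<in> fst d. q y \<noteq> 0}"
definition \<tau> :: "'w \<Rightarrow> complex^'k" where "\<tau> y = inverse (q y) *s \<sigma> y"

lemma lift: "is_lift d \<sigma>"
  unfolding \<sigma>_def Defs.lift_def by (rule someI_ex[OF lift_ex])

lemma open_d: "open (fst d)"
  using chart by (simp add: is_chart_def)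

lemma
  assumes "y \<in> fst d"
  shows \<sigma>_nz: "\<sigma> y \<noteq> 0" and cproj_\<sigma>: "cproj (\<sigma> y) = snd d y"
    and immersion_\<sigma>: "v \<noteq> 0 \<Longrightarrow> horizontal (\<sigma> y) (D \<sigma> y v) \<noteq> 0"
    and twice_\<sigma>: "twice_differentiable_at \<sigma> y"
  using lift assms smooth_on_twice_differentiable[OF _ open_d] by (auto simp: is_lift_def)

lemma twice_q: "y \<in> fst d \<Longrightarrow> twice_differentiable_at q y"
  unfolding q_def
  by (rule twice_differentiable_at_bounded_linear(1)
      [OF bounded_bilinear.bounded_linear_left[OF bounded_bilinear_hermitian] twice_\<sigma>])

lemma y0_V: "y0 \<in> V"
proof -
  have "cproj (\<sigma> y0) = cproj z" using cproj_\<sigma>[OF y0] z by simp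
  then obtain a where "a \<noteq> 0" "\<sigma> y0 = a *s z" using cproj_eqD \<sigma>_nz[OF y0] by metis
  then show ?thesis using z_unit y0 by (simp add: V_def q_def hermitian_simps hermitian_self)
qed

lemma open_V: "open V"
proof -
  have "continuous_on (fst d) q"
    using differentiable_at_if_twice[OF twice_q] differentiable_imp_continuous_within
    by (blast intro: continuous_at_imp_continuous_on)
  then have "open (fst d \<inter> q -` (- {0}))"
    by (rule continuous_open_preimage[OF _ open_d]) (simp add: open_Compl)
  then show ?thesis by (simp add: V_def vimage_def Int_def)
qed

lemma \<sigma>_eq: "y \<in> V \<Longrightarrow> \<sigma> y = q y *s \<tau> y"
  by (simp add: V_def \<tau>_def vector_smult_assoc)

lemma hermitian_\<tau>: "y \<in> V \<Longrightarrow> hermitian (\<tau> y) z = 1"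
  by (simp add: V_def \<tau>_def hermitian_simps flip: q_def)

text \<open>Normalization removes the freedom of scaling, and with it the arbitrary choice made in
  \<open>lift\<close>. This allows \<open>\<tau>\<close> to be compared with any other vector over
  the same point, in particular with the Legendrian lift.\<close>

lemma \<tau>_unique:
  assumes "y \<in> V" "cproj w = snd d y"
  shows "\<tau> y = inverse (hermitian w z) *s w"
proof -
  have "cproj (\<sigma> y) = cproj w" using assms cproj_\<sigma> by (simp add: V_def)
  then obtain a where "a \<noteq> 0" "\<sigma> y = a *s w"
    using cproj_eqD \<sigma>_nz assms(1) unfolding V_def by blast
  then show ?thesis by (simp add: \<tau>_def q_def hermitian_simps vector_smult_assoc)
qed

lemma \<tau>_y0: "\<tau> y0 = z"
  using \<tau>_unique[OF y0_V z] z_unit by (simp add: hermitian_self)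

lemma twice_\<tau>: "y \<in> V \<Longrightarrow> twice_differentiable_at \<tau> y"
  unfolding \<tau>_def
  by (rule twice_differentiable_at_bilinear(1)[OF bounded_bilinear_vector_scalar_mult
      twice_differentiable_at_inverse[OF twice_q] twice_\<sigma>]) (auto simp: V_def)

lemma eventually_V: "y \<in> V \<Longrightarrow> \<forall>\<^sub>F y' in nhds y. y' \<in> V"
  by (rule eventually_nhds_in_open[OF open_V])

lemma linear_D_\<tau>: "y \<in> V \<Longrightarrow> linear (D \<tau> y)"
  by (rule linear_D[OF differentiable_at_if_twice[OF twice_\<tau>]])

text \<open>In the product rule for \<open>\<sigma> = q \<tau>\<close> the derivative of
  \<open>q\<close> contributes a multiple of \<open>\<tau>\<close>, which is vertical.\<close>

lemma horizontal_D_\<sigma>: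
  assumes y: "y \<in> V"
  shows "horizontal (\<sigma> y) (D \<sigma> y v) = q y *s horizontal (\<tau> y) (D \<tau> y v)"
proof -
  have "y \<in> fst d" "q y \<noteq> 0" using y by (simp_all add: V_def)
  have "D \<sigma> y v = D (\<lambda>y. q y *s \<tau> y) y v"
    using eventually_V[OF y] by (intro fun_cong[OF D_cong_nhds]) (auto elim!: eventually_mono simp: \<sigma>_eq)
  also have "\<dots> = q y *s D \<tau> y v + D q y v *s \<tau> y"
    using \<open>y \<in> fst d\<close> y by (intro D_bilinear bounded_bilinear_vector_scalar_mult
        differentiable_at_if_twice twice_q twice_\<tau>)
  finally have "D \<sigma> y v = q y *s D \<tau> y v + D q y v *s \<tau> y" .
  moreover have "\<tau> y \<noteq> 0" using hermitian_\<tau>[OF y] by (auto simp: hermitian_simps)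
  ultimately show ?thesis
    using \<open>q y \<noteq> 0\<close> \<sigma>_eq[OF y]
    by (simp add: horizontal_scale horizontal_simps horizontal_self)
qed

lemma inj_D_\<tau>:
  assumes y: "y \<in> V"
  shows "inj (D \<tau> y)"
proof -
  have "v = 0" if "D \<tau> y v = 0" for v
    using horizontal_D_\<sigma>[OF y, of v] that immersion_\<sigma>[of y v] y
    by (auto simp: V_def horizontal_def hermitian_simps)
  then show ?thesis by (simp add: linear_injective_0[OF linear_D_\<tau>[OF y]])
qed

lemma quadric_metric_\<tau>:
  assumes y: "y \<in> V"
  shows "quadric_metric d y u v =
    (horizontal (\<tau> y) (D \<tau> y u) \<bullet> horizontal (\<tau> y) (D \<tau> y v)) / (\<tau> y \<bullet> \<tau> y)"
proof -
  have "(norm (\<sigma> y))\<^sup>2 = (norm (q y))\<^sup>2 * (\<tau> y \<bullet> \<tau> y)"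
    using \<sigma>_eq[OF y] by (simp add: norm_vector_scalar_mult power_mult_distrib power2_norm_eq_inner)
  then show ?thesis
    using y by (simp add: inner_vector_scalar_mult quadric_metric_def fubini_study_def horizontal_D_\<sigma> V_def flip: \<sigma>_def)
qed

lemma hermitian_D_\<tau>:
  assumes y: "y \<in> V"
  shows "hermitian (D \<tau> y v) z = 0"
proof -
  note L = bounded_bilinear.bounded_linear_left[OF bounded_bilinear_hermitian, of z]
  have "hermitian (D \<tau> y v) z = D (\<lambda>y. hermitian (\<tau> y) z) y v"
    by (simp add: D_bounded_linear[OF L differentiable_at_if_twice[OF twice_\<tau>[OF y]]])
  also have "\<dots> = D (\<lambda>_. 1 :: complex) y v"
    using eventually_V[OF y] by (intro fun_cong[OF D_cong_nhds]) (auto elim!: eventually_mono simp: hermitian_\<tau>)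
  finally show ?thesis by simp
qed

abbreviation "T \<equiv> D \<tau> y0"

lemmas linear_T = linear_D_\<tau>[OF y0_V]
  and inj_T = inj_D_\<tau>[OF y0_V]
  and hermitian_T = hermitian_D_\<tau>[OF y0_V]

lemma metric_y0: "quadric_metric d y0 u v = T u \<bullet> T v"
proof -
  have "horizontal z (T u) = T u" for u
    using hermitian_T by (simp add: horizontal_simps)
  then show ?thesis
    using z_unit by (simp add: quadric_metric_\<tau>[OF y0_V] \<tau>_y0 flip: power2_norm_eq_inner)
qed

lemma bilinear_metric: "bilinear (quadric_metric d y0)"
  unfolding bilinear_def metric_y0
  by (intro conjI allI linearI)
    (simp_all add: metric_y0 linear_add[OF linear_T] linear_cmul[OF linear_T] inner_add_left inner_add_right)

lemma metric_commute: "quadric_metric d y0 u v = quadric_metric d y0 v u"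
  by (simp add: metric_y0 inner_commute)

lemma metric_pos: "u \<noteq> 0 \<Longrightarrow> quadric_metric d y0 u u > 0"
  using inj_T linear_injective_0[OF linear_T] by (auto simp: metric_y0)

text \<open>The vertical correction \<open>c u\<close> vanishes at \<open>y0\<close>, so its
  derivative contributes only a multiple of \<open>z\<close>, which is orthogonal to the range of
  \<open>T\<close>; the denominator has derivative zero for the same reason. Hence the Christoffel
  symbols agree with those of the Euclidean metric induced by \<open>\<tau>\<close>.\<close>

lemma D_metric: "D (\<lambda>y. quadric_metric d y u v) y0 w = D2 \<tau> y0 w u \<bullet> T v + D2 \<tau> y0 w v \<bullet> T u"
proof -
  note tw = twice_\<tau>[OF y0_V] and d\<tau> = D_works[OF differentiable_at_if_twice[OF twice_\<tau>[OF y0_V]]]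
  define c where "c u y = hermitian (D \<tau> y u) (\<tau> y) / hermitian (\<tau> y) (\<tau> y)" for u y
  define a where "a u y = D \<tau> y u - c u y *s \<tau> y" for u y
  have a_eq: "horizontal (\<tau> y) (D \<tau> y u) = a u y" for u y
    by (simp add: a_def c_def horizontal_def)
  have c0: "c u y0 = 0" for u
    using hermitian_T by (simp add: c_def \<tau>_y0)
  have zz: "hermitian z z = 1" using z_unit by (simp add: hermitian_self)
  have "c u differentiable at y0" for u
    unfolding c_def
  proof (rule differentiable_divide)
    show "(\<lambda>y. hermitian (D \<tau> y u) (\<tau> y)) differentiable at y0"
      by (rule differentiableI[OF bounded_bilinear.FDERIV[OF bounded_bilinear_hermitian has_derivative_D[OF tw] d\<tau>]])
    show "(\<lambda>y. hermitian (\<tau> y) (\<tau> y)) differentiable at y0"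
      by (rule differentiableI[OF bounded_bilinear.FDERIV[OF bounded_bilinear_hermitian d\<tau> d\<tau>]])
  qed (simp add: \<tau>_y0 zz)
  then have "(a u has_derivative (\<lambda>w. D2 \<tau> y0 w u - (c u y0 *s T w + D (c u) y0 w *s \<tau> y0))) (at y0)" for u
    unfolding a_def
    by (intro has_derivative_diff has_derivative_D[OF tw]
        bounded_bilinear.FDERIV[OF bounded_bilinear_vector_scalar_mult D_works d\<tau>])
  then have da: "(a u has_derivative (\<lambda>w. D2 \<tau> y0 w u - D (c u) y0 w *s z)) (at y0)" for u
    by (simp add: c0 \<tau>_y0)
  have a0: "a u y0 = T u" for u
    by (simp add: a_def c0)
  have perp: "(b *s z) \<bullet> T v = 0" for b v
    using hermitian_T[of v] by (subst inner_commute) (simp add: inner_eq_Re_hermitian hermitian_simps)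
  have d1: "((\<lambda>y. a u y \<bullet> a v y) has_derivative (\<lambda>w. D2 \<tau> y0 w u \<bullet> T v + D2 \<tau> y0 w v \<bullet> T u)) (at y0)"
    using has_derivative_inner[OF da[of u] da[of v]]
    by (simp add: a0 inner_diff_left inner_diff_right perp inner_commute[of "T u"] add.commute)
  have "T w \<bullet> z = 0" for w
    using hermitian_T by (simp add: inner_eq_Re_hermitian)
  then have d2: "((\<lambda>y. \<tau> y \<bullet> \<tau> y) has_derivative (\<lambda>w. 0)) (at y0)"
    using has_derivative_inner[OF d\<tau> d\<tau>] by (simp add: \<tau>_y0 inner_commute)
  have "\<tau> y0 \<bullet> \<tau> y0 = 1"
    using zz by (simp add: \<tau>_y0 inner_eq_Re_hermitian)
  then have "((\<lambda>y. (a u y \<bullet> a v y) / (\<tau> y \<bullet> \<tau> y)) has_derivative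
      (\<lambda>w. D2 \<tau> y0 w u \<bullet> T v + D2 \<tau> y0 w v \<bullet> T u)) (at y0)"
    using has_derivative_divide[OF d1 d2] by simp
  moreover have "\<forall>\<^sub>F y in nhds y0. (a u y \<bullet> a v y) / (\<tau> y \<bullet> \<tau> y) = quadric_metric d y u v"
    using eventually_V[OF y0_V] by eventually_elim (simp add: quadric_metric_\<tau> a_eq)
  ultimately show ?thesis
    by (simp add: D_eqI has_derivative_cong_nhds)
qed

lemma bilinear_levi_civita_metric: "bilinear (levi_civita (quadric_metric d) y0)"
  and levi_civita_quadric_metric:
    "quadric_metric d y0 (levi_civita (quadric_metric d) y0 u v) w = D2 \<tau> y0 u v \<bullet> T w"
proof -
  note bil = bilinear_D2[OF twice_\<tau>[OF y0_V]]
  have nondeg: "u = 0" if "\<And>v. quadric_metric d y0 u v = 0" for u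
    using that[of u] metric_pos[of u] by force
  have H1: "linear (\<lambda>u. D2 \<tau> y0 u v \<bullet> T w)" for v w
    by (rule linearI) (simp_all add: bilinear_ladd[OF bil] bilinear_lmul[OF bil] inner_add_left)
  have H2: "linear (\<lambda>w. D2 \<tau> y0 u v \<bullet> T w)" for u v
    by (rule linearI) (simp_all add: linear_add[OF linear_T] linear_cmul[OF linear_T] inner_add_right)
  have H3: "D2 \<tau> y0 u v \<bullet> T w = D2 \<tau> y0 v u \<bullet> T w" for u v w
    by (simp add: D2_symmetric[OF twice_\<tau>[OF y0_V], of u v])
  note lc = bilinear_metric metric_commute nondeg H1 H2 H3 D_metric
  show "bilinear (levi_civita (quadric_metric d) y0)"
    by (rule bilinear_levi_civita[where H = "\<lambda>u v w. D2 \<tau> y0 u v \<bullet> T w", OF lc])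
  show "quadric_metric d y0 (levi_civita (quadric_metric d) y0 u v) w = D2 \<tau> y0 u v \<bullet> T w"
    by (rule levi_civita_metric[where H = "\<lambda>u v w. D2 \<tau> y0 u v \<bullet> T w", OF lc])
qed

lemma image_subset_quadric: "snd d ` fst d \<subseteq> quadric"
  using chart openin_subset unfolding is_chart_def by fastforce

text \<open>The point is existence: the rotated vector must again be tangent. Both conditions on
  \<open>T v\<close>, orthogonality to \<open>z\<close> and the differentiated equation of the
  quadric, are complex linear, and the dimension count shows that they cut out exactly the range of
  \<open>T\<close>.\<close>

lemma T_quadric_J: "T (quadric_J d y0 v) = \<i> *s T v"
proof -
  have sq: "sum_of_squares_form (\<tau> y) (\<tau> y) = 0" if "y \<in> V" for y
  proof -
    have "y \<in> fst d" using that by (simp add: V_def)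
    then have "cproj (\<sigma> y) \<in> quadric" using cproj_\<sigma> image_subset_quadric by auto
    then show ?thesis
      using quadric_iff[OF \<sigma>_nz[OF \<open>y \<in> fst d\<close>]] by (simp add: \<tau>_def sum_of_squares_form_simps(1,2))
  qed
  have "sum_of_squares_form (T v) z = 0" for v
  proof -
    have "D (\<lambda>y. sum_of_squares_form (\<tau> y) (\<tau> y)) y0 v = D (\<lambda>_. 0 :: complex) y0 v"
      using eventually_V[OF y0_V] by (intro fun_cong[OF D_cong_nhds]) (auto elim!: eventually_mono simp: sq)
    then show ?thesis
      using D_bilinear[OF bounded_bilinear_sum_of_squares_form, of \<tau> y0 \<tau> v]
        differentiable_at_if_twice[OF twice_\<tau>[OF y0_V]] sum_of_squares_form_simps(3)[of z]
      by (simp add: \<tau>_y0)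
  qed
  moreover have "sum_of_squares_form z z = 0" using sq[OF y0_V] by (simp add: \<tau>_y0)
  ultimately have "\<i> *s T v \<in> range T"
    using hermitian_complement_subset_range[OF linear_T inj_T dim z_unit] hermitian_T
    by (simp add: hermitian_simps sum_of_squares_form_simps(1))
  then obtain w where w: "T w = \<i> *s T v" by (metis imageE)
  have "horizontal (\<sigma> y0) (D \<sigma> y0 u) = q y0 *s T u" for u
    using horizontal_D_\<sigma>[OF y0_V] hermitian_T by (simp add: \<tau>_y0 horizontal_simps)
  then have "horizontal (\<sigma> y0) (D \<sigma> y0 u) = horizontal (\<sigma> y0) (\<i> *s D \<sigma> y0 v) \<longleftrightarrow> T u = T w" for u
    using y0_V by (simp add: horizontal_simps w V_def vec_eq_iff algebra_simps)
  then have "quadric_J d y0 v = w"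
    unfolding quadric_J_def \<sigma>_def[symmetric] using injD[OF inj_T] by auto
  then show ?thesis using w by simp
qed

end


section \<open>Parallel surfaces\<close>

lemma twice_differentiable_at_Pair:
  assumes f: "twice_differentiable_at f x" and g: "twice_differentiable_at g x"
  shows "twice_differentiable_at (\<lambda>y. (f y, g y)) x"
    and "D (\<lambda>y. (f y, g y)) x v = (D f x v, D g x v)"
    and "D2 (\<lambda>y. (f y, g y)) x u v = (D2 f x u v, D2 g x u v)"
proof -
  have D: "((\<lambda>y. (f y, g y)) has_derivative (\<lambda>v. (D f y v, D g y v))) (at y)"
    if "f differentiable at y" "g differentiable at y" for y
    using that by (intro has_derivative_Pair D_works)
  have fg: "\<forall>\<^sub>F y in nhds x. f differentiable at y \<and> g differentiable at y"
    using f g by (auto simp: twice_differentiable_at_def eventually_conj)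
  then have ev: "\<forall>\<^sub>F y in nhds x. D (\<lambda>y. (f y, g y)) y v = (D f y v, D g y v)" for v
    by eventually_elim (simp add: D_eqI[OF D])
  have der: "((\<lambda>y. (D f y v, D g y v)) has_derivative (\<lambda>u. (D2 f x u v, D2 g x u v))) (at x)" for v
    by (intro has_derivative_Pair has_derivative_D f g)
  show "D (\<lambda>y. (f y, g y)) x v = (D f x v, D g x v)"
    using f g by (simp add: D_eqI[OF D] differentiable_at_if_twice)
  show "D2 (\<lambda>y. (f y, g y)) x u v = (D2 f x u v, D2 g x u v)"
    unfolding D2_def[of "\<lambda>y. (f y, g y)"] D_cong_nhds[OF ev] by (simp add: D_eqI[OF der])
  have "\<forall>\<^sub>F y in nhds x. (\<lambda>y. (f y, g y)) differentiable at y"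
    using fg by eventually_elim (simp add: differentiableI[OF D])
  moreover have "(\<lambda>y. D (\<lambda>y. (f y, g y)) y v) differentiable at x" for v
    unfolding differentiable_cong_nhds[OF ev] by (rule differentiableI[OF der])
  ultimately show "twice_differentiable_at (\<lambda>y. (f y, g y)) x"
    by (simp add: twice_differentiable_at_def)
qed

text \<open>One rule for everything built linearly from \<open>f\<close> and \<open>\<nu>\<close>:
  parallel surfaces, their normals and the complex lift.\<close>

lemma twice_differentiable_at_linear_Pair:
  assumes P: "bounded_linear (\<lambda>p. P (fst p) (snd p))"
    and f: "twice_differentiable_at f x" and g: "twice_differentiable_at g x"
  shows "twice_differentiable_at (\<lambda>y. P (f y) (g y)) x"
    and "D (\<lambda>y. P (f y) (g y)) x v = P (D f x v) (D g x v)"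
    and "D2 (\<lambda>y. P (f y) (g y)) x u v = P (D2 f x u v) (D2 g x u v)"
  using twice_differentiable_at_bounded_linear[OF P twice_differentiable_at_Pair(1)[OF f g]]
    D_bounded_linear[OF P differentiable_at_if_twice[OF twice_differentiable_at_Pair(1)[OF f g]]]
  by (simp_all add: twice_differentiable_at_Pair[OF f g])

locale sphere_patch = hypersurface_patch U f \<nu>
  for U :: "'v::euclidean_space set" and f \<nu> :: "'v \<Rightarrow> 'a::euclidean_space" +
  assumes norm_f: "y \<in> U \<Longrightarrow> norm (f y) = 1" and norm_\<nu>: "y \<in> U \<Longrightarrow> norm (\<nu> y) = 1"
    and \<nu>_f: "y \<in> U \<Longrightarrow> \<nu> y \<bullet> f y = 0"
begin

lemmas diff_f = differentiable_at_if_twice[OF twice_f]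
  and diff_\<nu> = differentiable_at_if_twice[OF twice_\<nu>]

lemma
  assumes y: "y \<in> U"
  shows f_D_f: "f y \<bullet> D f y u = 0" and \<nu>_D_\<nu>: "\<nu> y \<bullet> D \<nu> y u = 0" and f_D_\<nu>: "f y \<bullet> D \<nu> y u = 0"
proof -
  have "D (\<lambda>y. f y \<bullet> f y) y u = 0" "D (\<lambda>y. \<nu> y \<bullet> \<nu> y) y u = 0" "D (\<lambda>y. \<nu> y \<bullet> f y) y u = 0"
    using y norm_f norm_\<nu> \<nu>_f by (intro D_eq_zero[of _ 1] D_eq_zero[of _ 0]; simp add: dot_square_norm)+
  then show "f y \<bullet> D f y u = 0" "\<nu> y \<bullet> D \<nu> y u = 0" "f y \<bullet> D \<nu> y u = 0"
    using normal[OF y, of u]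
    by (simp_all add: D_inner diff_f[OF y] diff_\<nu>[OF y] inner_commute[of "D f y u"] inner_commute[of "D \<nu> y u"])
qed

text \<open>The plane spanned by \<open>f y\<close> and \<open>\<nu> y\<close> is the same for every
  parallel pair, so these two normals serve for all \<open>t\<close>.\<close>

lemma in_range_if_orthogonal:
  assumes y: "y \<in> U" and dim: "DIM('v) + 2 = DIM('a)"
    and T: "linear T" "inj T" "\<And>u. f y \<bullet> T u = 0" "\<And>u. \<nu> y \<bullet> T u = 0"
    and w: "f y \<bullet> w = 0" "\<nu> y \<bullet> w = 0"
  shows "w \<in> range (T :: 'v \<Rightarrow> 'a)"
proof -
  have "f y \<bullet> f y = 1" using norm_f[OF y] by (simp add: dot_square_norm)
  then have "f y \<noteq> \<nu> y" using \<nu>_f[OF y] by auto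
  moreover have "f y \<noteq> 0" "\<nu> y \<noteq> 0" using norm_f[OF y] norm_\<nu>[OF y] by auto
  ultimately show ?thesis
    using dim T w \<nu>_f[OF y]
    by (intro orthogonal_complement_subset_range[of T "{f y, \<nu> y}"])
      (auto simp: pairwise_def orthogonal_def inner_commute)
qed

definition parallel :: "real \<Rightarrow> 'v \<Rightarrow> 'a" where
  "parallel t y = cos t *\<^sub>R f y + sin t *\<^sub>R \<nu> y"

definition conormal :: "real \<Rightarrow> 'v \<Rightarrow> 'a" where
  "conormal t y = - sin t *\<^sub>R f y + cos t *\<^sub>R \<nu> y"

lemma bounded_linear_combination:
  "bounded_linear (\<lambda>p. a *\<^sub>R fst p + b *\<^sub>R snd p :: 'b::real_normed_vector)"
  by (intro bounded_linear_add bounded_linear_const_scaleR bounded_linear_fst bounded_linear_snd)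

lemmas parallel_derivs = twice_differentiable_at_linear_Pair[where P = "\<lambda>u v. cos t *\<^sub>R u + sin t *\<^sub>R v" for t,
    OF bounded_linear_combination twice_f twice_\<nu>, folded parallel_def]
  and conormal_derivs = twice_differentiable_at_linear_Pair[where P = "\<lambda>u v. - sin t *\<^sub>R u + cos t *\<^sub>R v" for t,
    OF bounded_linear_combination twice_f twice_\<nu>, folded conormal_def]

lemma cubic_form_parallel:
  assumes y: "y \<in> U"
  shows "cubic_form (parallel t) (conormal t) y u v w = cubic_form f \<nu> y u v w"
proof -
  \<comment> \<open>The antisymmetric pairing of \<open>(p, q)\<close> with \<open>(r, s)\<close>
    scales by the determinant of the matrix applied to both pairs, which is 1 for a
    rotation.\<close>
  have "(a *\<^sub>R p + b *\<^sub>R q) \<bullet> (- b *\<^sub>R r + a *\<^sub>R s) - (- b *\<^sub>R p + a *\<^sub>R q) \<bullet> (a *\<^sub>R r + b *\<^sub>R s) =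
      (a\<^sup>2 + b\<^sup>2) * (p \<bullet> s - q \<bullet> r)" for a b :: real and p q r s :: 'a
    by (simp add: inner_add_left inner_add_right inner_diff_left inner_diff_right power2_eq_square algebra_simps)
  then show ?thesis
    unfolding cubic_form_def parallel_derivs[OF y y] conormal_derivs[OF y y] by simp
qed

lemma immersed_parallel:
  assumes imm: "\<And>y. y \<in> U \<Longrightarrow> inj (D (parallel t) y)" and dim: "DIM('v) + 2 = DIM('a)"
  shows "immersed_patch U (parallel t) (conormal t)"
proof
  fix y assume y: "y \<in> U"
  note zero = f_D_f[OF y] \<nu>_D_\<nu>[OF y] f_D_\<nu>[OF y] normal[OF y]
  show "twice_differentiable_at (parallel t) y" "twice_differentiable_at (conormal t) y"
    by (rule parallel_derivs[OF y y] conormal_derivs[OF y y])+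
  show "conormal t y \<bullet> D (parallel t) y u = 0" for u
    unfolding parallel_derivs[OF y y] by (simp add: conormal_def inner_add_left inner_add_right zero inner_diff_left)
  show "inj (D (parallel t) y)" by (rule imm[OF y])
  show "D (conormal t) y u \<in> range (D (parallel t) y)" for u
  proof (rule in_range_if_orthogonal[OF y dim])
    show "linear (D (parallel t) y)"
      by (rule linear_D[OF differentiable_at_if_twice[OF parallel_derivs(1)[OF y y]]])
    show "inj (D (parallel t) y)" by (rule imm[OF y])
  qed (simp_all add: parallel_derivs[OF y y] conormal_derivs[OF y y] inner_add_right inner_diff_right zero)
qed (rule open_U)

end


section \<open>The Lagrangian immersion\<close>

definition complexify :: "real^'k \<Rightarrow> real^'k \<Rightarrow> complex^'k" where
  "complexify a b = (1 / sqrt 2) *\<^sub>R (\<chi> i. of_real (a $ i) + \<i> * of_real (b $ i))"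

lemma bounded_linear_complexify: "bounded_linear (\<lambda>p. complexify (fst p) (snd p))"
  unfolding linear_conv_bounded_linear[symmetric]
  by (rule linearI) (simp_all add: complexify_def vec_eq_iff complex_eq_iff add_divide_distrib)

text \<open>The imaginary part is the antisymmetric pairing that occurs in
  \<open>cubic_form\<close>; its denominator 2 becomes the factor 2 between the two tensors.\<close>

lemma hermitian_complexify:
  "hermitian (complexify a b) (complexify c e) = Complex ((a \<bullet> c + b \<bullet> e) / 2) ((b \<bullet> c - a \<bullet> e) / 2)"
proof -
  have "hermitian (complexify a b) (complexify c e) =
      (1 / 2) *\<^sub>R hermitian (\<chi> i. of_real (a $ i) + \<i> * of_real (b $ i)) (\<chi> i. of_real (c $ i) + \<i> * of_real (e $ i))"
    by (simp add: complexify_def hermitian_simps)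
  then show ?thesis
    by (simp add: complex_eq_iff hermitian_def inner_vec_def sum.distrib sum_subtractf algebra_simps)
qed

lemma sum_of_squares_form_complexify:
  "sum_of_squares_form (complexify a b) (complexify a b) = Complex ((a \<bullet> a - b \<bullet> b) / 2) (a \<bullet> b)"
proof -
  have "sum_of_squares_form (complexify a b) (complexify a b) =
      (\<Sum>i\<in>UNIV. (1 / 2) *\<^sub>R ((of_real (a $ i) + \<i> * of_real (b $ i)) * (of_real (a $ i) + \<i> * of_real (b $ i))))"
    by (simp add: complexify_def sum_of_squares_form_def)
  then show ?thesis
    by (simp add: complex_eq_iff inner_vec_def sum_distrib_left sum_divide_distrib
        flip: sum.distrib sum_subtractf)
qed

lemma norm_complexify: "norm (complexify a b) = sqrt ((a \<bullet> a + b \<bullet> b) / 2)"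
  by (simp add: norm_eq_sqrt_inner[where 'a = "complex^'k"] inner_eq_Re_hermitian hermitian_complexify)

lemma openin_quadric_vimage:
  fixes h :: "'v::real_normed_vector \<Rightarrow> complex^'k"
  assumes S: "openin (subtopology cp_topology quadric) S" and U: "open U" and h: "continuous_on U h"
    and hq: "\<And>y. y \<in> U \<Longrightarrow> h y \<noteq> 0 \<and> cproj (h y) \<in> quadric"
  shows "open {y \<in> U. cproj (h y) \<in> S}"
proof -
  obtain W where W: "openin cp_topology W" "S = W \<inter> quadric"
    using S by (auto simp: openin_subtopology)
  have "open (U \<inter> h -` {z. z \<noteq> 0 \<and> cproj z \<in> W})"
    using W(1) by (intro continuous_open_preimage[OF h U]) (simp add: openin_cp_topology)
  moreover have "U \<inter> h -` {z. z \<noteq> 0 \<and> cproj z \<in> W} = {y \<in> U. cproj (h y) \<in> S}"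
    using hq W(2) by auto
  ultimately show ?thesis by simp
qed

locale lagrangian_patch = sphere_patch U f \<nu>
  for U :: "'v::euclidean_space set" and f \<nu> :: "'v \<Rightarrow> real^'k" +
  fixes d :: "('w::euclidean_space, (complex^'k) set) chart" and x :: 'v
  assumes immersion: "y \<in> U \<Longrightarrow> inj (D f y)"
    and quadric_chart: "is_chart (subtopology cp_topology quadric) d"
    and quadric_lift: "\<exists>\<sigma>. is_lift d \<sigma>"
    and dim: "DIM('w) + 4 = 2 * CARD('k)"
    and x: "x \<in> U" "cproj (complexify (f x) (\<nu> x)) \<in> snd d ` fst d"
begin

definition h :: "'v \<Rightarrow> complex^'k" where "h y = complexify (f y) (\<nu> y)"
definition l :: "'v \<Rightarrow> 'w" where "l y = inv_into (fst d) (snd d) (cproj (h y))"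

lemmas h_derivs = twice_differentiable_at_linear_Pair[OF bounded_linear_complexify twice_f twice_\<nu>, folded h_def]

lemma norm_h: "y \<in> U \<Longrightarrow> norm (h y) = 1"
  using norm_f norm_\<nu> by (simp add: h_def norm_complexify dot_square_norm)

lemma h_nz: "y \<in> U \<Longrightarrow> h y \<noteq> 0"
  using norm_h by fastforce

lemma l_dom: "cproj (h y) \<in> snd d ` fst d \<Longrightarrow> l y \<in> fst d \<and> snd d (l y) = cproj (h y)"
  unfolding l_def by (rule conjI[OF inv_into_into f_inv_into_f])

text \<open>Normalizing against \<open>h x\<close> itself gives \<open>\<tau> (l x) = h x\<close>
  and \<open>p x = 1\<close>, so that derivatives of \<open>h\<close> and \<open>\<tau>\<close>
  compare without rescaling.\<close>

sublocale normalized_lift d "l x" "h x"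
proof
  have "l x \<in> fst d \<and> snd d (l x) = cproj (h x)"
    using l_dom x(2) by (simp only: h_def)
  then show "l x \<in> fst d" "cproj (h x) = snd d (l x)" by simp_all
  show "norm (h x) = 1" by (rule norm_h[OF x(1)])
qed (rule quadric_chart quadric_lift dim)+

section \<open>Regularity of the chart expression of the Lagrangian immersion\<close>

lemma open_vimage:
  assumes "openin (subtopology cp_topology quadric) S"
  shows "open {y \<in> U. cproj (h y) \<in> S}"
proof (rule openin_quadric_vimage[OF assms open_U])
  show "continuous_on U h"
    by (intro continuous_at_imp_continuous_on ballI differentiable_imp_continuous_within
        differentiable_at_if_twice h_derivs(1))
  show "h y \<noteq> 0 \<and> cproj (h y) \<in> quadric" if "y \<in> U" for y
    using that \<nu>_f norm_f norm_\<nu> h_nz[OF that]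
    by (simp add: quadric_iff) (simp add: h_def sum_of_squares_form_complexify inner_commute[of "f y"]
      dot_square_norm complex_eq_iff)
qed

lemma openin_image:
  assumes "open S" "S \<subseteq> fst d"
  shows "openin (subtopology cp_topology quadric) (snd d ` S)"
proof (rule openin_trans_full)
  show "openin (subtopology cp_topology quadric) (snd d ` fst d)"
    using quadric_chart by (simp add: is_chart_def)
  have "open_map (top_of_set (fst d)) (subtopology (subtopology cp_topology quadric) (snd d ` fst d)) (snd d)"
    using quadric_chart by (auto simp: is_chart_def intro: homeomorphic_imp_open_map)
  moreover have "openin (top_of_set (fst d)) S"
    using assms openin_open_eq[OF open_d] by simp
  ultimately show "openin (subtopology (subtopology cp_topology quadric) (snd d ` fst d)) (snd d ` S)"
    unfolding open_map_def by blast
qed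

lemma inj_chart: "inj_on (snd d) (fst d)"
  using quadric_chart by (auto simp: is_chart_def dest: homeomorphic_imp_injective_map)

text \<open>Keeps \<open>l y\<close> inside the affine domain \<open>V\<close>; where the image
  misses the chart, \<open>l\<close> has arbitrary values.\<close>

definition U' :: "'v set" where
  "U' = {y \<in> U. cproj (h y) \<in> snd d ` V}"

lemma open_U': "open U'"
  unfolding U'_def by (intro open_vimage openin_image open_V) (auto simp: V_def)

lemma U'D:
  assumes "y \<in> U'"
  shows "y \<in> U" "l y \<in> V" "snd d (l y) = cproj (h y)"
proof -
  show "y \<in> U" using assms by (simp add: U'_def)
  obtain v where v: "v \<in> V" "cproj (h y) = snd d v" using assms by (auto simp: U'_def)
  then have "v \<in> fst d" by (simp add: V_def)
  then have l: "l y \<in> fst d" "snd d (l y) = cproj (h y)" using l_dom[of y] v by auto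
  then have "l y = v" using inj_onD[OF inj_chart, of "l y" v] v \<open>v \<in> fst d\<close> by simp
  then show "l y \<in> V" "snd d (l y) = cproj (h y)" using v l by simp_all
qed

lemma x_U': "x \<in> U'"
proof -
  have "snd d (l x) = cproj (h x)" using l_dom x by (simp add: h_def)
  then show ?thesis using x(1) y0_V by (auto simp: U'_def intro: rev_image_eqI)
qed

lemma eventually_U': "y \<in> U' \<Longrightarrow> \<forall>\<^sub>F y' in nhds y. y' \<in> U'"
  by (rule eventually_nhds_in_open[OF open_U'])

text \<open>As \<open>l\<close> is a bare \<open>inv_into\<close>, continuity must come from
  topology: the chart is open onto its image, and open sets of the quadric pull back along
  \<open>h\<close> by the quotient topology. Differentiability is built on this.\<close>

lemma isCont_l:
  assumes y: "y \<in> U'"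
  shows "isCont l y"
proof -
  have "\<forall>\<^sub>F y' in nhds y. l y' \<in> S" if S: "open S" "l y \<in> S" for S
  proof -
    have "open {y' \<in> U. cproj (h y') \<in> snd d ` (S \<inter> fst d)}"
      using S open_d by (intro open_vimage openin_image) auto
    moreover have "y \<in> {y' \<in> U. cproj (h y') \<in> snd d ` (S \<inter> fst d)}"
      using U'D[OF y] S by (auto simp: V_def intro: rev_image_eqI)
    ultimately have "\<forall>\<^sub>F y' in nhds y. y' \<in> {y' \<in> U. cproj (h y') \<in> snd d ` (S \<inter> fst d)}"
      by (rule eventually_nhds_in_open)
    then show ?thesis
    proof eventually_elim
      case (elim y')
      then obtain s where s: "s \<in> S" "s \<in> fst d" "cproj (h y') = snd d s" by auto
      then have "l y' \<in> fst d" "snd d (l y') = snd d s" using l_dom[of y'] by auto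
      then show ?case using s inj_onD[OF inj_chart, of "l y'" s] by simp
    qed
  qed
  then have "filterlim l (nhds (l y)) (nhds y)" by (rule topological_tendstoI)
  then show ?thesis by (simp add: isCont_def tendsto_at_iff_tendsto_nhds)
qed

definition p :: "'v \<Rightarrow> complex" where "p y = hermitian (h y) (h x)"
definition \<phi> :: "'v \<Rightarrow> complex^'k" where "\<phi> y = inverse (p y) *s h y"

lemma \<tau>_l: "y \<in> U' \<Longrightarrow> \<tau> (l y) = \<phi> y"
  using \<tau>_unique[of "l y" "h y"] U'D by (simp add: \<phi>_def p_def)

lemma p_nz: "y \<in> U' \<Longrightarrow> p y \<noteq> 0"
  using hermitian_\<tau>[of "l y"] U'D(2)[of y] \<tau>_l[of y] by (auto simp: \<phi>_def hermitian_simps)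

lemma h_eq: "y \<in> U' \<Longrightarrow> h y = p y *s \<phi> y"
  using p_nz by (simp add: \<phi>_def vector_smult_assoc)

lemma p_derivs:
  assumes "y \<in> U"
  shows "twice_differentiable_at p y" "D p y v = hermitian (D h y v) (h x)"
    "D2 p y u v = hermitian (D2 h y u v) (h x)"
proof -
  note L = bounded_bilinear.bounded_linear_left[OF bounded_bilinear_hermitian, of "h x"]
  note h = h_derivs(1)[OF assms assms]
  show "twice_differentiable_at p y" "D2 p y u v = hermitian (D2 h y u v) (h x)"
    unfolding p_def by (rule twice_differentiable_at_bounded_linear[OF L h])+
  show "D p y v = hermitian (D h y v) (h x)"
    unfolding p_def by (simp add: D_bounded_linear[OF L differentiable_at_if_twice[OF h]])
qed

lemma twice_\<phi>: "y \<in> U' \<Longrightarrow> twice_differentiable_at \<phi> y"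
  unfolding \<phi>_def
  by (rule twice_differentiable_at_bilinear(1)[OF bounded_bilinear_vector_scalar_mult
      twice_differentiable_at_inverse[OF p_derivs(1) p_nz] h_derivs(1)]) (auto dest: U'D(1))

lemma diff_l:
  assumes y: "y \<in> U'"
  shows "l differentiable at y"
proof (rule differentiable_left_factor)
  show "\<tau> differentiable at (l y)" "inj (D \<tau> (l y))"
    using U'D(2)[OF y] by (simp_all add: differentiable_at_if_twice twice_\<tau> inj_D_\<tau>)
  show "\<phi> differentiable at y" by (rule differentiable_at_if_twice[OF twice_\<phi>[OF y]])
  show "\<forall>\<^sub>F y' in nhds y. \<tau> (l y') = \<phi> y'"
    using eventually_U'[OF y] by eventually_elim (rule \<tau>_l)
qed (rule isCont_l[OF y])

lemma D_\<tau>_l: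
  assumes y: "y \<in> U'"
  shows "D \<tau> (l y) (D l y v) = D \<phi> y v"
proof -
  have der: "((\<lambda>y. \<tau> (l y)) has_derivative (\<lambda>v. D \<tau> (l y) (D l y v))) (at y)"
    by (rule has_derivative_compose[OF D_works[OF diff_l[OF y]]
        D_works[OF differentiable_at_if_twice[OF twice_\<tau>[OF U'D(2)[OF y]]]]])
  have "\<forall>\<^sub>F y' in nhds y. \<tau> (l y') = \<phi> y'"
    using eventually_U'[OF y] by eventually_elim (rule \<tau>_l)
  from fun_cong[OF D_cong_nhds[OF this], of v] show ?thesis by (simp add: D_eqI[OF der])
qed

lemma D_\<tau>_l_eventually: "\<forall>\<^sub>F y in nhds x. D \<tau> (l y) (D l y v) = D \<phi> y v"
  using eventually_U'[OF x_U'] by eventually_elim (rule D_\<tau>_l)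

text \<open>The derivative of \<open>l\<close> solves the linear system
  \<open>D \<tau> (l y) (D l y v) = D \<phi> y v\<close>, whose coefficients and right-hand side are
  differentiable at \<open>x\<close>.\<close>

lemma twice_l: "twice_differentiable_at l x"
  unfolding twice_differentiable_at_def
proof (intro conjI allI)
  show "\<forall>\<^sub>F y in nhds x. l differentiable at y"
    using eventually_U'[OF x_U'] by eventually_elim (rule diff_l)
  show "(\<lambda>y. D l y v) differentiable at x" for v
  proof (rule differentiable_linear_solution)
    show "\<forall>\<^sub>F y in nhds x. linear (D \<tau> (l y))"
      using eventually_U'[OF x_U'] by eventually_elim (rule linear_D_\<tau>[OF U'D(2)])
    show "(\<lambda>y. D \<tau> (l y) v) differentiable at x" for v
      by (rule differentiableI[OF has_derivative_compose[OF D_works[OF diff_l[OF x_U']]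
          has_derivative_D[OF twice_\<tau>[OF y0_V]]]])
    show "(\<lambda>y. D \<phi> y v) differentiable at x"
      by (rule twice_differentiable_atD[OF twice_\<phi>[OF x_U']])
  qed (rule inj_T D_\<tau>_l_eventually)+
qed

section \<open>Derivatives of the Legendrian lift in terms of the chart expression\<close>

lemma p_x: "p x = 1"
  using norm_h[OF x(1)] by (simp add: p_def hermitian_self)

text \<open>The real part expresses constant length, the imaginary part the contact condition. At
  \<open>x\<close> it says that the first derivative of the scaling factor \<open>p\<close>
  vanishes.\<close>

lemma hermitian_D_h: "y \<in> U \<Longrightarrow> hermitian (D h y v) (h y) = 0"
  by (simp add: h_derivs h_def hermitian_complexify complex_eq_iff inner_commute[of "D f y v"]
      inner_commute[of "D \<nu> y v"] f_D_f \<nu>_D_\<nu> f_D_\<nu> normal)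

lemma D_h_eq: "D h x v = T (D l x v)"
proof -
  have "\<forall>\<^sub>F y in nhds x. h y = p y *s \<phi> y"
    using eventually_U'[OF x_U'] by eventually_elim (rule h_eq)
  from fun_cong[OF D_cong_nhds[OF this]]
  have "D h x v = D (\<lambda>y. p y *s \<phi> y) x v" .
  also have "\<dots> = p x *s D \<phi> x v + D p x v *s \<phi> x"
    by (intro D_bilinear bounded_bilinear_vector_scalar_mult differentiable_at_if_twice
        p_derivs(1) twice_\<phi> x x_U')
  finally show ?thesis
    by (simp add: p_x p_derivs(2)[OF x(1)] hermitian_D_h[OF x(1)] D_\<tau>_l[OF x_U'])
qed

text \<open>In the product rule for \<open>h = p \<phi>\<close> the mixed terms drop out since
  \<open>D p x = 0\<close>. The first two summands represent the covariant derivative along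
  \<open>l\<close> when paired with tangent vectors.\<close>

lemma D2_h_eq: "D2 h x u v = T (D2 l x u v) + D2 \<tau> (l x) (D l x u) (D l x v) + D2 p x u v *s h x"
proof -
  have "D2 \<phi> x u v = D (\<lambda>y. D \<tau> (l y) (D l y v)) x u"
    unfolding D2_def by (rule fun_cong[OF D_cong_nhds[OF D_\<tau>_l_eventually, symmetric]])
  also have "\<dots> = D2 \<tau> (l x) (D l x u) (D l x v) + T (D2 l x u v)"
    by (simp add: D_eqI[OF has_derivative_D_field[OF twice_\<tau>[OF y0_V] diff_l[OF x_U']
            twice_differentiable_atD[OF twice_l, of v]]] D2_def[of l])
  finally have "D2 \<phi> x u v = D2 \<tau> (l x) (D l x u) (D l x v) + T (D2 l x u v)" .
  moreover have "D2 h x u v = D2 (\<lambda>y. p y *s \<phi> y) x u v"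
  proof -
    have ev: "\<forall>\<^sub>F y in nhds x. p y *s \<phi> y = h y"
      using eventually_U'[OF x_U'] by eventually_elim (rule h_eq[symmetric])
    have "twice_differentiable_at (\<lambda>y. p y *s \<phi> y) x"
      by (rule twice_differentiable_at_bilinear(1)[OF bounded_bilinear_vector_scalar_mult
            p_derivs(1)[OF x(1)] twice_\<phi>[OF x_U']])
    from twice_differentiable_at_cong(2)[OF ev this] show ?thesis by (rule fun_cong[OF fun_cong])
  qed
  moreover have "\<phi> x = h x" by (simp add: \<phi>_def p_x)
  ultimately show ?thesis
    by (simp add: twice_differentiable_at_bilinear(2)[OF bounded_bilinear_vector_scalar_mult p_derivs(1)[OF x(1)] twice_\<phi>[OF x_U']]
        p_x p_derivs(2)[OF x(1)] hermitian_D_h[OF x(1)] add.commute)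
qed

lemma inj_D_l: "inj (D l x)"
proof -
  have "v = 0" if "D l x v = 0" for v
  proof -
    have "complexify (D f x v) (D \<nu> x v) = 0"
      using that D_h_eq[of v] linear_0[OF linear_T] by (simp add: h_derivs[OF x(1) x(1)])
    then have "D f x v \<bullet> D f x v + D \<nu> x v \<bullet> D \<nu> x v = 0"
      using norm_complexify[of "D f x v" "D \<nu> x v"] by simp
    then have "D f x v = 0"
      by (simp add: add_nonneg_eq_0_iff)
    then show ?thesis
      using immersion[OF x(1)] linear_injective_0[OF linear_D[OF diff_f[OF x(1)]]] by blast
  qed
  then show ?thesis
    by (simp add: linear_injective_0[OF linear_D[OF diff_l[OF x_U']]])
qed

text \<open>Multiplying by the imaginary unit turns the real product with the normal vector into the
  imaginary part of a Hermitian product of derivatives of \<open>h\<close>. The direction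
  \<open>u\<close> that defines the normal lands in the last slot.\<close>

lemma shape_form_eq_cubic_form:
  defines "G \<equiv> quadric_metric d"
  shows "pullback G l x (normal_shape_op G l x (- quadric_J d (l x) (D l x u)) v) w =
    cubic_form f \<nu> x v w u / 2"
proof -
  let ?N = "- quadric_J d (l x) (D l x u)"
  have TN: "T ?N = - (\<i> *s D h x u)"
    using D_h_eq by (simp add: linear_neg[OF linear_T] T_quadric_J)
  \<comment> \<open>The Lagrangian condition: evaluated on derivatives of \<open>h\<close>, it is
    the symmetry of the shape form.\<close>
  have "G (l x) (D l x v) ?N = 0" for v
    using shape_form_symmetric[OF x(1), of u v] inner_commute
    by (simp add: G_def metric_y0 TN flip: D_h_eq)
      (simp add: inner_eq_Re_hermitian hermitian_simps h_derivs[OF x(1) x(1)] hermitian_complexify inner_commute)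
  then have "pullback G l x (normal_shape_op G l x ?N v) w =
      G (l x) (D2 l x v w + levi_civita G (l x) (D l x v) (D l x w)) ?N"
    unfolding G_def
    by (intro pullback_normal_shape_op bilinear_metric metric_commute metric_pos
        bilinear_levi_civita_metric twice_l inj_D_l)
  also have "\<dots> = (T (D2 l x v w) + D2 \<tau> (l x) (D l x v) (D l x w)) \<bullet> T ?N"
    unfolding G_def bilinear_ladd[OF bilinear_metric] levi_civita_quadric_metric
    unfolding metric_y0 by (simp add: inner_add_left)
  also have "\<dots> = (D2 h x v w - D2 p x v w *s h x) \<bullet> - (\<i> *s D h x u)"
    unfolding TN D2_h_eq by simp
  \<comment> \<open>The leftover multiple of \<open>h x\<close> is Hermitian orthogonal to
    \<open>D h x u\<close>, hence also to its rotation.\<close>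
  also have "\<dots> = D2 h x v w \<bullet> - (\<i> *s D h x u)"
  proof -
    have "hermitian (h x) (D h x u) = 0"
      using hermitian_D_h[OF x(1), of u] by (subst hermitian_commute) simp
    then show ?thesis by (simp add: inner_diff_left inner_eq_Re_hermitian hermitian_simps)
  qed
  also have "\<dots> = cubic_form f \<nu> x v w u / 2"
    by (simp add: inner_eq_Re_hermitian hermitian_simps h_derivs[OF x(1) x(1)] hermitian_complexify
        cubic_form_def diff_divide_distrib)
  finally show ?thesis .
qed

end

text \<open>A nonzero kernel vector would be an eigenvector of the shape operator with eigenvalue
  \<open>cot t\<close>. Equality of cotangents fixes \<open>t\<close> modulo \<open>pi\<close>, and
  the normalized angles are exactly odd multiples of \<open>pi / (2 * g)\<close>.\<close>

lemma inj_D_parallel_regular: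
  fixes f \<nu> :: "'v::euclidean_space \<Rightarrow> 'a::euclidean_space"
  assumes patch: "immersed_patch U f \<nu>" and y: "y \<in> U"
    and pc: "principal_curvatures f \<nu> y \<subseteq> {cot \<theta> |\<theta>. \<exists>j\<in>{1..g}. \<exists>m::int.
      \<theta> = (2 * real j - 1) * (pi / (2 * real g)) + of_int m * pi}"
    and t: "t \<in> regular_set g"
    and zero: "cos t *\<^sub>R D f y u + sin t *\<^sub>R D \<nu> y u = 0"
  shows "u = 0"
proof (rule ccontr)
  assume u: "u \<noteq> 0"
  interpret immersed_patch U f \<nu> by (rule patch)
  note lin = linear_D_f[OF y]
  have "D f y (cos t *\<^sub>R u - sin t *\<^sub>R shape_op f \<nu> y u) = 0"
    using zero by (simp add: linear_diff[OF lin] linear_cmul[OF lin] D_shape_op[OF y])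
  then have A: "cos t *\<^sub>R u = sin t *\<^sub>R shape_op f \<nu> y u"
    using immersion[OF y] unfolding linear_injective_0[OF lin] by (metis right_minus_eq)
  have s: "sin t \<noteq> 0"
  proof
    assume "sin t = 0"
    then have "cos t = 0" using A u by simp
    then show False using \<open>sin t = 0\<close> sin_cos_squared_add[of t] by simp
  qed
  then have "shape_op f \<nu> y u = cot t *\<^sub>R u"
    using arg_cong[OF A, of "\<lambda>w. (1 / sin t) *\<^sub>R w"] by (simp add: cot_def)
  then have "cot t \<in> principal_curvatures f \<nu> y"
    using u by (auto simp: principal_curvatures_def)
  then obtain \<theta> j and m :: int where j: "j \<in> {1..g}" and cot: "cot t = cot \<theta>"
    and \<theta>: "\<theta> = (2 * real j - 1) * (pi / (2 * real g)) + of_int m * pi"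
    using pc by blast
  \<comment> \<open>Since \<open>cot\<close> is totalized to 0 at its poles, equality of cotangents
    says nothing unless poles are excluded. Parity does it: \<open>2 * j - 1\<close> is odd, while a
    pole would make it a multiple of \<open>2 * g\<close>.\<close>
  have "sin \<theta> \<noteq> 0"
  proof
    assume "sin \<theta> = 0"
    then obtain i :: int where "\<theta> = of_int i * pi" by (auto simp: sin_zero_iff_int2)
    then have "(2 * real j - 1) * (pi / (2 * real g)) = (of_int i - of_int m) * pi"
      using \<theta> by (simp add: algebra_simps)
    then have "(2 * real j - 1) * pi = ((of_int i - of_int m) * (2 * real g)) * pi"
      using j by (simp add: field_simps)
    then have "2 * real j - 1 = (of_int i - of_int m) * (2 * real g)"
      by (simp only: mult_right_cancel[OF pi_neq_zero])
    then have "of_int (2 * int j - 1) = (of_int ((i - m) * (2 * int g)) :: real)" by simp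
    then have "2 * int j - 1 = (i - m) * (2 * int g)" by (simp only: of_int_eq_iff)
    then have "even (2 * int j - 1)" by simp
    then show False by simp
  qed
  then have "sin (t - \<theta>) = 0"
    using cot s by (simp add: sin_diff cot_def field_simps)
  then obtain i :: int where "t = \<theta> + of_int i * pi"
    by (auto simp: sin_zero_iff_int2 algebra_simps)
  \<comment> \<open>Rewrite \<open>2 * j - 1\<close> as \<open>2 * (j - 1) + 1\<close> and each
    \<open>pi\<close> as \<open>2 * g\<close> units of \<open>pi / (2 * g)\<close>.\<close>
  then have "t = (2 * of_int (int j - 1 + (m + i) * int g) + 1) * (pi / (2 * real g))"
    using \<theta> j by (simp add: field_simps)
  then show False using t unfolding regular_set_def by blast
qed

theorem theoremA:
  fixes T :: "'m topology"
    and \<A> :: "(real^'n, 'm) chart set"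
    and F \<nu> :: "'m \<Rightarrow> real^'k"
    and g :: nat and \<kappa> \<theta> :: "nat \<Rightarrow> real"
  assumes "CARD('k) = CARD('n) + 2"
    and "smooth_manifold T \<A>" and "connected_space T"
    and "g \<ge> 1"
    and "isoparametric T \<A> F \<nu> g \<kappa>"
    and "\<forall>j\<in>{1..g}. \<kappa> j = cot (\<theta> j) \<and>
           (\<exists>m::int. \<theta> j = (2 * real j - 1) * (pi / (2 * real g)) + of_int m * pi)"
  shows "(\<forall>t\<in>regular_set g. \<forall>X Y Z.
            vector_field \<A> X \<and> vector_field \<A> Y \<and> vector_field \<A> Z \<longrightarrow>
            (\<forall>c\<in>\<A>. \<forall>d\<in>(quadric_atlas :: (complex^'n, (complex^'k) set) chart set).
               \<forall>x\<in>local_dom c d (lagrangian F \<nu>).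
                 2 * alpha_hat (lagrangian F \<nu>) X Y Z c d x = alpha F \<nu> t X Y Z c x)) \<and>
         (\<forall>s\<in>regular_set g. \<forall>t\<in>regular_set g. \<forall>X Y Z.
            vector_field \<A> X \<and> vector_field \<A> Y \<and> vector_field \<A> Z \<longrightarrow>
            (\<forall>c\<in>\<A>. \<forall>x\<in>fst c. alpha F \<nu> s X Y Z c x = alpha F \<nu> t X Y Z c x))"
proof -
  have iso: "smooth_embedding T \<A> F" "F ` topspace T \<subseteq> sphere 0 1" "unit_normal \<A> F \<nu>"
    "\<And>c x. c \<in> \<A> \<Longrightarrow> x \<in> fst c \<Longrightarrow> principal_curvatures (F \<circ> snd c) (\<nu> \<circ> snd c) x = \<kappa> ` {1..g}"
    using assms(5) by (simp_all add: isoparametric_def)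
  have imm: "inj (D (F \<circ> snd c) x)" if "c \<in> \<A>" "x \<in> fst c" for c x
    using iso(1) that by (simp add: smooth_embedding_def)
  have patch: "sphere_patch (fst c) (F \<circ> snd c) (\<nu> \<circ> snd c)" if c: "c \<in> \<A>" for c
  proof
    show U: "open (fst c)"
      using assms(2) c by (simp add: smooth_manifold_def is_chart_def)
    fix y assume y: "y \<in> fst c"
    have "snd c y \<in> topspace T"
      using assms(2) c y unfolding smooth_manifold_def by blast
    then show "norm ((F \<circ> snd c) y) = 1" using iso(2) by auto
    show "twice_differentiable_at (F \<circ> snd c) y" "twice_differentiable_at (\<nu> \<circ> snd c) y"
      using iso(1,3) c
      by (auto simp: smooth_embedding_def unit_normal_def smooth_map_def
          intro: smooth_on_twice_differentiable[OF _ U y])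
    show "norm ((\<nu> \<circ> snd c) y) = 1" "(\<nu> \<circ> snd c) y \<bullet> (F \<circ> snd c) y = 0"
      "(\<nu> \<circ> snd c) y \<bullet> D (F \<circ> snd c) y u = 0" for u
      using iso(3) c y by (simp_all add: unit_normal_def)
  qed
  have dim: "DIM(real^'n) + 2 = DIM(real^'k)" using assms(1) by simp
  have alpha: "alpha F \<nu> t X Y Z c x = cubic_form (F \<circ> snd c) (\<nu> \<circ> snd c) x (X c x) (Y c x) (Z c x)"
    if t: "t \<in> regular_set g" and Y: "vector_field \<A> Y" and c: "c \<in> \<A>" and x: "x \<in> fst c" for t X Y Z c x
  proof -
    interpret sphere_patch "fst c" "F \<circ> snd c" "\<nu> \<circ> snd c" by (rule patch[OF c])
    have par: "parallel_surface F \<nu> t \<circ> snd c = parallel t" "parallel_normal F \<nu> t \<circ> snd c = conormal t" for t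
      by (simp_all add: fun_eq_iff parallel_surface_def parallel_normal_def parallel_def conormal_def)
    have p0: "parallel 0 = F \<circ> snd c" "conormal 0 = \<nu> \<circ> snd c"
      by (simp_all add: fun_eq_iff parallel_def conormal_def)
    \<comment> \<open>At \<open>t = 0\<close> the parallel pair is the given one; this supplies the
      shape operator of the original patch, which the argument at regular \<open>t\<close> relies
      on.\<close>
    have immersed: "immersed_patch (fst c) (F \<circ> snd c) (\<nu> \<circ> snd c)"
      using immersed_parallel[of 0, OF _ dim] imm[OF c] by (simp add: p0)
    have "principal_curvatures (F \<circ> snd c) (\<nu> \<circ> snd c) y \<subseteq> {cot \<theta> |\<theta>. \<exists>j\<in>{1..g}. \<exists>m::int.
        \<theta> = (2 * real j - 1) * (pi / (2 * real g)) + of_int m * pi}" if "y \<in> fst c" for y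
      using assms(6) unfolding iso(4)[OF c that] by blast
    note inj0 = inj_D_parallel_regular[OF immersed _ this t]
    have "inj (D (parallel t) y)" if y: "y \<in> fst c" for y
      using inj0[OF y y]
      by (subst linear_injective_0[OF linear_D[OF differentiable_at_if_twice[OF parallel_derivs(1)[OF y y]]]])
        (auto simp: parallel_derivs(2)[OF y y])
    then interpret t: immersed_patch "fst c" "parallel t" "conormal t"
      by (rule immersed_parallel[OF _ dim])
    have "Y c differentiable at x"
      using Y c x open_U by (intro differentiable_at_if_twice smooth_on_twice_differentiable[of "fst c"])
        (auto simp: vector_field_def)
    from t.nabla_shape_op[OF x this, of "X c" "Z c x"] show ?thesis
      by (simp add: alpha_def par cubic_form_parallel[OF x])
  qed
  have alpha_hat: "2 * alpha_hat (lagrangian F \<nu>) X Y Z c d x =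
      cubic_form (F \<circ> snd c) (\<nu> \<circ> snd c) x (X c x) (Y c x) (Z c x)"
    if c: "c \<in> \<A>" and d: "d \<in> (quadric_atlas :: (complex^'n, (complex^'k) set) chart set)"
      and x: "x \<in> local_dom c d (lagrangian F \<nu>)" for X Y Z c d x
  proof -
    interpret sphere_patch "fst c" "F \<circ> snd c" "\<nu> \<circ> snd c" by (rule patch[OF c])
    have x': "x \<in> fst c" using x by (simp add: local_dom_def)
    have L: "lagrangian F \<nu> (snd c y) = cproj (complexify ((F \<circ> snd c) y) ((\<nu> \<circ> snd c) y))" for y
      by (simp add: lagrangian_def legendrian_lift_def parallel_surface_def parallel_normal_def complexify_def)
    interpret l: lagrangian_patch "fst c" "F \<circ> snd c" "\<nu> \<circ> snd c" d x
    proof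
      show "cproj (complexify ((F \<circ> snd c) x) ((\<nu> \<circ> snd c) x)) \<in> snd d ` fst d"
        using x L[of x] by (simp add: local_dom_def)
    qed (use d x' imm[OF c] assms(1) in \<open>auto simp: quadric_atlas_def DIM_complex\<close>)
    have "local_rep c d (lagrangian F \<nu>) = l.l"
      by (simp add: fun_eq_iff local_rep_def L l.l_def l.h_def)
    then have "2 * alpha_hat (lagrangian F \<nu>) X Y Z c d x =
        cubic_form (F \<circ> snd c) (\<nu> \<circ> snd c) x (Y c x) (Z c x) (X c x)"
      by (simp add: alpha_hat_def l.shape_form_eq_cubic_form)
    \<comment> \<open>On the quadric side \<open>X\<close> sits in the last slot, as it defines the
      normal, whereas for \<alpha> it is the direction of differentiation. Two transpositions
      reconcile the orders.\<close>
    also have "\<dots> = cubic_form (F \<circ> snd c) (\<nu> \<circ> snd c) x (Y c x) (X c x) (Z c x)"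
      by (rule cubic_form_commute_right[OF x'])
    also have "\<dots> = cubic_form (F \<circ> snd c) (\<nu> \<circ> snd c) x (X c x) (Y c x) (Z c x)"
      by (rule cubic_form_commute[OF twice_f[OF x'] twice_\<nu>[OF x']])
    finally show ?thesis .
  qed
  show ?thesis
    using alpha alpha_hat by (auto simp: local_dom_def)
qed

end
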